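(* Let $X$ be a Banach space, $U\subset X$ an open neighborhood of the origin, $M$ a smooth finite-dimensional manifold, and let $F:U\to M$ be a smooth mapping having a critical point at $0$ of corank $h\geq 1$. Then: (i) If $h=1$ and there exists $v\in\mathrm{dom}(\mathcal{D}_0^3F)$ such that $\mathcal{D}_0^3F(v)\neq 0$, then $F$ is open at the origin. (ii) For any $h\geq 1$, if there exist $w_0\in\mathrm{Iso}(\mathcal{D}_0^2F)$ and $v_0\in\mathrm{dom}(\mathcal{D}_0^3F)$ such that $v_0$ is a $w_0$-regular zero for $\mathcal{D}_0^3F$, then $F$ is open at the origin.
   Context: Smooth means $C^\infty$. "$F$ is open at the origin" means that for every neighborhood $V\subset U$ of $0$, $F(V)$ is a neighborhood of $F(0)$. Critical points. The point $0$ is a critical point of $F$ if $d_0F:X\to T_{F(0)}M$ is not surjective; $\mathrm{coker}(d_0F)=T_{F(0)}M/\mathrm{Im}(d_0F)$, with quotient projection $\pi_{\mathrm{coker}(d_0F)}$, and the corank is $\dim\mathrm{coker}(d_0F)$. Derivatives. In a local chart of $M$ centered at $F(0)$ (i.e. sending $F(0)$ to $0$), set $d_0^kF(v)=\frac{d^k}{dt^k}F(tv)\big|_{t=0}$, and let $d_0^kF(v_1,\dots,v_k)$ be the associated symmetric $k$-linear map. The following objects do not depend on the chosen chart. Intrinsic Hessian: $\mathcal{D}_0^2F:\ker(d_0F)\to\mathrm{coker}(d_0F)$, $\mathcal{D}_0^2F(v)=\pi_{\mathrm{coker}(d_0F)}(d_0^2F(v))$, with associated symmetric bilinear map $\mathcal{D}_0^2F(v,w)$.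 Isotropy space: $\mathrm{Iso}(\mathcal{D}_0^2F)=\{w\in\ker(d_0F): \mathcal{D}_0^2F(w)=0\}$. Domain of the third differential: $$\mathrm{dom}(\mathcal{D}_0^3F)=\{v\in\ker(d_0F): \pi_{\mathrm{coker}(d_0F)}(d_0^2F(v,x))=0\ \text{for all } x\in X\},$$ a linear subspace of $\ker(d_0F)$. Third differential: the cubic map $\mathcal{D}_0^3F:\mathrm{dom}(\mathcal{D}_0^3F)\to\mathrm{coker}(d_0F)$, $\mathcal{D}_0^3F(v)=\pi_{\mathrm{coker}(d_0F)}(d_0^3F(v))$, with associated symmetric trilinear map $\mathcal{D}_0^3F(v_1,v_2,v_3)$. For $w_0\in\mathrm{Iso}(\mathcal{D}_0^2F)$: $\mathrm{Im}(F,2,w_0)=\mathrm{Im}(\mathcal{D}_0^2F(w_0,\cdot))\subset\mathrm{coker}(d_0F)$ (image of $\ker(d_0F)$), and $\mathrm{coker}(F,2,w_0)=\mathrm{coker}(d_0F)/\mathrm{Im}(F,2,w_0)$ with quotient projection $\pi_{\mathrm{coker}(F,2,w_0)}$. A $w_0$-regular zero for $\mathcal{D}_0^3F$ is an element $v\in\mathrm{dom}(\mathcal{D}_0^3F)$ such that $\mathcal{D}_0^3F(v)=0$ and the linear map $\pi_{\mathrm{coker}(F,2,w_0)}(\mathcal{D}_0^3F(v,v,\cdot)):\mathrm{dom}(\mathcal{D}_0^3F)\to\mathrm{coker}(F,2,w_0)$ is surjective. *)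

theory Defs
  imports "HOL-Analysis.Analysis" "HOL-Library.Set_Algebras"
begin

section \<open>Multilinear maps and smoothness in normed spaces\<close>

text \<open>
  A \<open>k\<close>-linear map is represented by a function on argument lists; only its values on
  lists of length \<open>k\<close> matter.
\<close>

definition multilinear_map :: "nat \<Rightarrow> ('a::real_vector list \<Rightarrow> 'b::real_vector) \<Rightarrow> bool" where
  "multilinear_map k m \<longleftrightarrow>
     (\<forall>us vs. length us + length vs + 1 = k \<longrightarrow> linear (\<lambda>x. m (us @ x # vs)))"

definition bounded_multilinear_map ::
  "nat \<Rightarrow> ('a::real_normed_vector list \<Rightarrow> 'b::real_normed_vector) \<Rightarrow> bool" where
  "bounded_multilinear_map k m \<longleftrightarrow> multilinear_map k m \<and>
     (\<exists>C. \<forall>vs. length vs = k \<longrightarrow> norm (m vs) \<le> C * prod_list (map norm vs))"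

definition symmetric_map :: "nat \<Rightarrow> ('a list \<Rightarrow> 'b) \<Rightarrow> bool" where
  "symmetric_map k m \<longleftrightarrow>
     (\<forall>vs ws. length vs = k \<longrightarrow> mset vs = mset ws \<longrightarrow> m vs = m ws)"

text \<open>
  \<open>C\<^sup>\<infinity>\<close> in the sense of Frechet: \<open>D k x\<close> is the \<open>k\<close>-th derivative at \<open>x\<close>, an element of the
  space of bounded \<open>k\<close>-linear maps, and \<open>D (Suc k) x\<close> is the Frechet derivative of \<open>D k\<close> at
  \<open>x\<close> with respect to the operator norm on that space.  Here
  \<open>L(X, L\<^sup>k(X;Y))\<close> is identified with \<open>L\<^sup>k\<^sup>+\<^sup>1(X;Y)\<close>, which lets all orders live in one type.
  Meant for open \<open>S\<close>.
\<close>

definition smooth_on ::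
  "'a::real_normed_vector set \<Rightarrow> ('a \<Rightarrow> 'b::real_normed_vector) \<Rightarrow> bool" where
  "smooth_on S f \<longleftrightarrow>
     (\<exists>D :: nat \<Rightarrow> 'a \<Rightarrow> 'a list \<Rightarrow> 'b.
        (\<forall>x\<in>S. D 0 x [] = f x) \<and>
        (\<forall>k. \<forall>x\<in>S. bounded_multilinear_map k (D k x)) \<and>
        (\<forall>k. \<forall>x\<in>S. \<forall>e>0. \<forall>\<^sub>F y in at x within S. \<forall>vs. length vs = k \<longrightarrow>
           norm (D k y vs - D k x vs - D (Suc k) x ((y - x) # vs))
             \<le> e * norm (y - x) * prod_list (map norm vs)))"


section \<open>Smooth manifolds and smooth mappings into them\<close>

text \<open>
  A chart is a pair of its domain and its coordinate map.  The manifold is a whole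
  (Hausdorff, second countable) type together with a smooth atlas, which need not be maximal.
\<close>

type_synonym ('m, 'e) chart = "'m set \<times> ('m \<Rightarrow> 'e)"

definition is_chart :: "('m::topological_space, 'e::euclidean_space) chart \<Rightarrow> bool" where
  "is_chart c \<longleftrightarrow> (case c of (D, \<phi>) \<Rightarrow>
     open D \<and> open (\<phi> ` D) \<and> (\<exists>\<psi>. homeomorphism D (\<phi> ` D) \<phi> \<psi>))"

definition smooth_transition ::
  "('m::topological_space, 'e::euclidean_space) chart \<Rightarrow> ('m, 'e) chart \<Rightarrow> bool" where
  "smooth_transition c c' \<longleftrightarrow> (case (c, c') of ((D, \<phi>), (D', \<phi>')) \<Rightarrow>
     smooth_on (\<phi> ` (D \<inter> D')) (\<phi>' \<circ> inv_into D \<phi>))"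

definition smooth_atlas ::
  "('m::{t2_space,second_countable_topology}, 'e::euclidean_space) chart set \<Rightarrow> bool" where
  "smooth_atlas A \<longleftrightarrow>
     (\<forall>c\<in>A. is_chart c) \<and> (\<Union>c\<in>A. fst c) = UNIV \<and> (\<forall>c\<in>A. \<forall>c'\<in>A. smooth_transition c c')"

text \<open>The charts of the manifold are those of the maximal atlas generated by \<open>A\<close>.\<close>

definition smooth_chart ::
  "('m::{t2_space,second_countable_topology}, 'e::euclidean_space) chart set \<Rightarrow>
     ('m, 'e) chart \<Rightarrow> bool" where
  "smooth_chart A c \<longleftrightarrow>
     is_chart c \<and> (\<forall>c'\<in>A. smooth_transition c c' \<and> smooth_transition c' c)"

definition smooth_mapping ::
  "('m::{t2_space,second_countable_topology}, 'e::euclidean_space) chart set \<Rightarrow>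
     'a::real_normed_vector set \<Rightarrow> ('a \<Rightarrow> 'm) \<Rightarrow> bool" where
  "smooth_mapping A U F \<longleftrightarrow> continuous_on U F \<and>
     (\<forall>(D, \<phi>)\<in>A. smooth_on (U \<inter> F -` D) (\<phi> \<circ> F))"

definition open_at_origin ::
  "'a::real_normed_vector set \<Rightarrow> ('a \<Rightarrow> 'm::topological_space) \<Rightarrow> bool" where
  "open_at_origin U F \<longleftrightarrow>
     (\<forall>V\<subseteq>U. 0 \<in> interior V \<longrightarrow> F 0 \<in> interior (F ` V))"


section \<open>Differentials at the origin\<close>

text \<open>
  Throughout, \<open>G\<close> stands for the representation \<open>\<phi> \<circ> F\<close> of the mapping in a chart \<open>\<phi>\<close> centered
  at \<open>F(0)\<close>; this chart identifies the tangent space of the manifold at \<open>F(0)\<close> with \<open>'e\<close>.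
\<close>

definition diff0 :: "('a::real_normed_vector \<Rightarrow> 'e::real_normed_vector) \<Rightarrow> 'a \<Rightarrow> 'e" where
  "diff0 G = frechet_derivative G (at 0)"

definition ker_diff0 :: "('a::real_normed_vector \<Rightarrow> 'e::real_normed_vector) \<Rightarrow> 'a set" where
  "ker_diff0 G = {v. diff0 G v = 0}"

definition ndiff0 ::
  "nat \<Rightarrow> ('a::real_normed_vector \<Rightarrow> 'e::real_normed_vector) \<Rightarrow> 'a \<Rightarrow> 'e" where
  "ndiff0 k G v = ((\<lambda>g t. vector_derivative g (at t)) ^^ k) (\<lambda>t::real. G (t *\<^sub>R v)) 0"

text \<open>
  The symmetric \<open>k\<close>-linear map whose restriction to the diagonal is \<open>ndiff0 k G\<close>.  The last
  clause only fixes the irrelevant values, so that the map is unique as a function on lists.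
\<close>

definition ndiff0_multi ::
  "nat \<Rightarrow> ('a::real_normed_vector \<Rightarrow> 'e::real_normed_vector) \<Rightarrow> 'a list \<Rightarrow> 'e" where
  "ndiff0_multi k G = (THE m. multilinear_map k m \<and> symmetric_map k m \<and>
     (\<forall>v. m (replicate k v) = ndiff0 k G v) \<and> (\<forall>vs. length vs \<noteq> k \<longrightarrow> m vs = 0))"


section \<open>Cokernel, intrinsic Hessian and third differential\<close>

text \<open>
  Elements of a quotient space are cosets \<open>y +o W\<close>; the sum of cosets is the sum of sets, the
  zero element is \<open>W\<close> itself.
\<close>

definition coker_proj ::
  "('a::real_normed_vector \<Rightarrow> 'e::real_normed_vector) \<Rightarrow> 'e \<Rightarrow> 'e set" where
  "coker_proj G y = y +o range (diff0 G)"

definition coker0 :: "('a::real_normed_vector \<Rightarrow> 'e::real_normed_vector) \<Rightarrow> 'e set set" where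
  "coker0 G = range (coker_proj G)"

text \<open>
  The cokernel has dimension \<open>h\<close>: the classes of some \<open>b 0, \<dots>, b (h - 1)\<close> form a basis, that is,
  every class is a linear combination of them with unique coefficients.
\<close>

definition has_corank :: "('a::real_normed_vector \<Rightarrow> 'e::real_normed_vector) \<Rightarrow> nat \<Rightarrow> bool" where
  "has_corank G h \<longleftrightarrow>
     (\<exists>b :: nat \<Rightarrow> 'e. \<forall>y\<in>coker0 G. \<exists>!c :: nat \<Rightarrow> real.
        c \<in> {..<h} \<rightarrow>\<^sub>E UNIV \<and> y = coker_proj G (\<Sum>i<h. c i *\<^sub>R b i))"

definition Hess_bilin ::
  "('a::real_normed_vector \<Rightarrow> 'e::real_normed_vector) \<Rightarrow> 'a \<Rightarrow> 'a \<Rightarrow> 'e set" where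
  "Hess_bilin G v w = coker_proj G (ndiff0_multi 2 G [v, w])"

definition Hess :: "('a::real_normed_vector \<Rightarrow> 'e::real_normed_vector) \<Rightarrow> 'a \<Rightarrow> 'e set" where
  "Hess G v = coker_proj G (ndiff0 2 G v)"

definition Iso :: "('a::real_normed_vector \<Rightarrow> 'e::real_normed_vector) \<Rightarrow> 'a set" where
  "Iso G = {w \<in> ker_diff0 G. Hess G w = coker_proj G 0}"

definition dom_third :: "('a::real_normed_vector \<Rightarrow> 'e::real_normed_vector) \<Rightarrow> 'a set" where
  "dom_third G =
     {v \<in> ker_diff0 G. \<forall>x. coker_proj G (ndiff0_multi 2 G [v, x]) = coker_proj G 0}"

definition third :: "('a::real_normed_vector \<Rightarrow> 'e::real_normed_vector) \<Rightarrow> 'a \<Rightarrow> 'e set" where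
  "third G v = coker_proj G (ndiff0 3 G v)"

definition third_trilin ::
  "('a::real_normed_vector \<Rightarrow> 'e::real_normed_vector) \<Rightarrow> 'a \<Rightarrow> 'a \<Rightarrow> 'a \<Rightarrow> 'e set" where
  "third_trilin G u v w = coker_proj G (ndiff0_multi 3 G [u, v, w])"

definition Im2 :: "('a::real_normed_vector \<Rightarrow> 'e::real_normed_vector) \<Rightarrow> 'a \<Rightarrow> 'e set set" where
  "Im2 G w0 = Hess_bilin G w0 ` ker_diff0 G"

text \<open>The quotient of the cokernel by \<open>Im2 G w0\<close>: its elements are cosets of cosets.\<close>

definition coker2_proj ::
  "('a::real_normed_vector \<Rightarrow> 'e::real_normed_vector) \<Rightarrow> 'a \<Rightarrow> 'e set \<Rightarrow> 'e set set" where
  "coker2_proj G w0 y = y +o Im2 G w0"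

definition coker2 ::
  "('a::real_normed_vector \<Rightarrow> 'e::real_normed_vector) \<Rightarrow> 'a \<Rightarrow> 'e set set set" where
  "coker2 G w0 = coker2_proj G w0 ` coker0 G"

definition regular_zero ::
  "('a::real_normed_vector \<Rightarrow> 'e::real_normed_vector) \<Rightarrow> 'a \<Rightarrow> 'a \<Rightarrow> bool" where
  "regular_zero G w0 v \<longleftrightarrow> v \<in> dom_third G \<and> third G v = coker_proj G 0 \<and>
     (\<lambda>u. coker2_proj G w0 (third_trilin G v v u)) ` dom_third G = coker2 G w0"

end

theory Submission
  imports Defs
begin

text \<open>
  Write \<open>L\<close>, \<open>Q\<close>, \<open>C\<close> for the first three derivatives at \<open>0\<close> of \<open>F\<close> in the chart, \<open>P\<close> for a linear
  projection onto the image of \<open>L\<close> and \<open>\<pi> = 1 - P\<close>.  Points are taken of the form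
  \<open>x = s\<^sup>4 a + s\<^sup>5 w + s\<^sup>7 k + s\<^sup>8 z\<close> with \<open>a\<close> in the domain of the third differential, \<open>w\<close> isotropic and
  \<open>k\<close> in the kernel of \<open>L\<close>.  The exponents are such that, after dividing the \<open>P\<close>-part of the value by
  \<open>s\<^sup>8\<close> and the \<open>\<pi>\<close>-part by \<open>s\<^sup>1\<^sup>2\<close>, all that survives as \<open>s \<rightarrow> 0\<close> is
  \<open>L z + P Q(a,a)/2\<close> and \<open>\<pi> (Q(w,k) + C(a,a,a)/6)\<close>.  Letting \<open>a\<close>, \<open>k\<close>, \<open>z\<close> depend continuously on a
  parameter \<open>y\<close> in a ball of the target space so that this limit is close to \<open>y\<close>, Brouwer's theorem
  shows that the values cover a neighbourhood of \<open>0\<close>.  In case (ii) \<open>a\<close> and \<open>k\<close> are affine in \<open>y\<close> and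
  come from a right inverse of the derivative; in case (i), \<open>w = k = 0\<close> and \<open>a\<close> is a cube root of a
  linear functional of \<open>y\<close> times the vector \<open>v\<close>.
\<close>

section \<open>Calculus of three times continuously differentiable maps\<close>

text \<open>The derivative takes values in the normed space of bounded operators, so the predicate
  can be applied to the derivative itself, which gives \<open>has_C3_derivatives\<close> by
  iteration.\<close>

definition has_C1_derivative ::
  "'a::real_normed_vector set \<Rightarrow> ('a \<Rightarrow> 'b::real_normed_vector) \<Rightarrow> ('a \<Rightarrow> 'a \<Rightarrow>\<^sub>L 'b) \<Rightarrow> bool" where
  "has_C1_derivative S f f' \<longleftrightarrow>
     (\<forall>x\<in>S. (f has_derivative blinfun_apply (f' x)) (at x)) \<and> continuous_on S f'"

lemma has_C1_derivative_continuous_on: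
  "has_C1_derivative S f f' \<Longrightarrow> continuous_on S f"
  unfolding has_C1_derivative_def
  by (meson continuous_at_imp_continuous_on has_derivative_continuous)

lemma has_C1_derivative_subset:
  "has_C1_derivative S f f' \<Longrightarrow> T \<subseteq> S \<Longrightarrow> has_C1_derivative T f f'"
  unfolding has_C1_derivative_def by (meson continuous_on_subset subsetD)

lemma has_C1_derivative_cong:
  assumes "has_C1_derivative S f f'" "open S" "\<And>x. x \<in> S \<Longrightarrow> f x = g x"
  shows "has_C1_derivative S g f'"
  using assms unfolding has_C1_derivative_def
  by (meson has_derivative_transform_within_open)

lemma has_C1_derivative_compose:
  assumes f: "has_C1_derivative T f f'" and g: "has_C1_derivative S g g'" and "g ` S \<subseteq> T"
  shows "has_C1_derivative S (\<lambda>x. f (g x)) (\<lambda>x. f' (g x) o\<^sub>L g' x)"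
  unfolding has_C1_derivative_def
proof (intro conjI ballI)
  fix x assume "x \<in> S"
  then have "(g has_derivative g' x) (at x)" "(f has_derivative f' (g x)) (at (g x))"
    using assms unfolding has_C1_derivative_def by auto
  then have "((\<lambda>x. f (g x)) has_derivative (\<lambda>h. f' (g x) (g' x h))) (at x)"
    by (rule has_derivative_compose)
  then show "((\<lambda>x. f (g x)) has_derivative blinfun_apply (f' (g x) o\<^sub>L g' x)) (at x)"
    by (simp add: blinfun_compose.rep_eq comp_def)
next
  have "continuous_on S (\<lambda>x. f' (g x))"
    using assms has_C1_derivative_continuous_on[OF g] unfolding has_C1_derivative_def
    by (auto intro: continuous_on_compose2)
  then show "continuous_on S (\<lambda>x. f' (g x) o\<^sub>L g' x)"
    using g unfolding has_C1_derivative_def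
    by (auto intro!: continuous_intros bounded_bilinear.continuous_on[OF bounded_bilinear_blinfun_compose])
qed

lemma has_C1_derivative_bounded_linear:
  assumes "bounded_linear l" and g: "has_C1_derivative S g g'"
  shows "has_C1_derivative S (\<lambda>x. l (g x)) (\<lambda>x. Blinfun l o\<^sub>L g' x)"
proof (rule has_C1_derivative_compose[OF _ g])
  show "has_C1_derivative UNIV l (\<lambda>_. Blinfun l)"
    unfolding has_C1_derivative_def
    using assms(1) by (auto simp: bounded_linear_Blinfun_apply intro: bounded_linear_imp_has_derivative)
qed simp

lemma has_C1_derivative_add:
  assumes "has_C1_derivative S f f'" and "has_C1_derivative S g g'"
  shows "has_C1_derivative S (\<lambda>x. f x + g x) (\<lambda>x. f' x + g' x)"
  using assms unfolding has_C1_derivative_def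
  by (auto intro!: continuous_intros has_derivative_add simp: blinfun.add_left[abs_def])

lemma has_C1_derivative_bilinear:
  assumes p: "bounded_bilinear p"
    and f: "has_C1_derivative S f f'" and g: "has_C1_derivative S g g'"
  shows "has_C1_derivative S (\<lambda>x. p (f x) (g x))
    (\<lambda>x. (bounded_bilinear.prod_right p (f x) o\<^sub>L g' x) + (bounded_bilinear.prod_left p (g x) o\<^sub>L f' x))"
proof -
  interpret p: bounded_bilinear p by fact
  have cont: "continuous_on S f" "continuous_on S g" "continuous_on S f'" "continuous_on S g'"
    using f g has_C1_derivative_continuous_on unfolding has_C1_derivative_def by blast+
  show ?thesis
    unfolding has_C1_derivative_def
  proof (intro conjI ballI)
    fix x assume "x \<in> S"
    then have "(f has_derivative f' x) (at x)" "(g has_derivative g' x) (at x)"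
      using f g unfolding has_C1_derivative_def by auto
    from p.FDERIV[OF this]
    show "((\<lambda>x. p (f x) (g x)) has_derivative
        blinfun_apply ((p.prod_right (f x) o\<^sub>L g' x) + (p.prod_left (g x) o\<^sub>L f' x))) (at x)"
      by (simp add: plus_blinfun.rep_eq p.prod_right.rep_eq p.prod_left.rep_eq)
  next
    show "continuous_on S (\<lambda>x. (p.prod_right (f x) o\<^sub>L g' x) + (p.prod_left (g x) o\<^sub>L f' x))"
      by (intro continuous_intros bounded_bilinear.continuous_on[OF bounded_bilinear_blinfun_compose]
          bounded_linear.continuous_on[OF p.bounded_linear_prod_right]
          bounded_linear.continuous_on[OF p.bounded_linear_prod_left] cont)
  qed
qed

definition has_C3_derivatives ::
  "'a::real_normed_vector set \<Rightarrow> ('a \<Rightarrow> 'b::real_normed_vector) \<Rightarrow> ('a \<Rightarrow> 'a \<Rightarrow>\<^sub>L 'b) \<Rightarrow>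
     ('a \<Rightarrow> 'a \<Rightarrow>\<^sub>L 'a \<Rightarrow>\<^sub>L 'b) \<Rightarrow> ('a \<Rightarrow> 'a \<Rightarrow>\<^sub>L 'a \<Rightarrow>\<^sub>L 'a \<Rightarrow>\<^sub>L 'b) \<Rightarrow> bool" where
  "has_C3_derivatives S f f1 f2 f3 \<longleftrightarrow>
     has_C1_derivative S f f1 \<and> has_C1_derivative S f1 f2 \<and> has_C1_derivative S f2 f3"

lemma has_C3_derivatives_cong:
  assumes "has_C3_derivatives S f f1 f2 f3" "open S" "\<And>x. x \<in> S \<Longrightarrow> f x = g x"
  shows "has_C3_derivatives S g f1 f2 f3"
  using assms has_C1_derivative_cong[of S f f1 g] unfolding has_C3_derivatives_def by auto

lemma has_C3_derivatives_subset:
  "has_C3_derivatives S f f1 f2 f3 \<Longrightarrow> T \<subseteq> S \<Longrightarrow> has_C3_derivatives T f f1 f2 f3"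
  unfolding has_C3_derivatives_def by (auto intro: has_C1_derivative_subset)

text \<open>The chain rule gives \<open>f1 (g x) o\<^sub>L g1 x\<close>. As operator composition is
  bilinear, each further derivative is again covered by the product rule and the chain rule.
  Existence is enough here; the resulting formulas are never evaluated.\<close>

lemma has_C3_derivatives_compose:
  fixes g :: "'a::real_normed_vector \<Rightarrow> 'b::real_normed_vector"
    and f :: "'b \<Rightarrow> 'c::real_normed_vector"
  assumes f: "has_C3_derivatives T f f1 f2 f3" and g: "has_C3_derivatives S g g1 g2 g3"
    and "g ` S \<subseteq> T"
  shows "\<exists>h1 h2 h3. has_C3_derivatives S (\<lambda>x. f (g x)) h1 h2 h3"
proof -
  have f: "has_C1_derivative T f f1" "has_C1_derivative T f1 f2" "has_C1_derivative T f2 f3"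
    and g: "has_C1_derivative S g g1" "has_C1_derivative S g1 g2" "has_C1_derivative S g2 g3"
    using assms unfolding has_C3_derivatives_def by auto
  interpret c: bounded_bilinear "(o\<^sub>L) :: ('b \<Rightarrow>\<^sub>L 'c) \<Rightarrow> ('a \<Rightarrow>\<^sub>L 'b) \<Rightarrow> _"
    by (rule bounded_bilinear_blinfun_compose)
  note compose = has_C1_derivative_compose[OF _ g(1) assms(3)]
    and bilinear = has_C1_derivative_bilinear[OF bounded_bilinear_blinfun_compose]
  \<comment> \<open>\<open>h1\<close> gives the second derivative as a sum of two operator products;
    \<open>a\<close> and \<open>b\<close> differentiate its first and its second summand.\<close>
  note h1 = bilinear[OF compose[OF f(2)] g(2)]
  note a = bilinear[OF has_C1_derivative_bounded_linear[OF c.bounded_linear_prod_right compose[OF f(2)]] g(3)]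
  note b = bilinear[OF has_C1_derivative_bounded_linear[OF c.bounded_linear_prod_left g(2)]
      bilinear[OF compose[OF f(3)] g(2)]]
  show ?thesis
    unfolding has_C3_derivatives_def using compose[OF f(1)] h1 has_C1_derivative_add[OF a b] by blast
qed

section \<open>Multilinear maps on lists as nested bounded operators\<close>

lemma bounded_multilinear_map_Suc:
  assumes "bounded_multilinear_map (Suc k) m"
  shows "bounded_multilinear_map k (\<lambda>vs. m (u # vs))"
proof -
  obtain C where C: "\<And>vs. length vs = Suc k \<Longrightarrow> norm (m vs) \<le> C * prod_list (map norm vs)"
    and m: "multilinear_map (Suc k) m"
    using assms unfolding bounded_multilinear_map_def by blast
  have "linear (\<lambda>x. m ((u # us) @ x # vs))" if "length us + length vs + 1 = k" for us vs
    using m that unfolding multilinear_map_def by (metis add_Suc length_Cons)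
  moreover have "norm (m (u # vs)) \<le> C * norm u * prod_list (map norm vs)" if "length vs = k" for vs
    using C[of "u # vs"] that by (simp add: mult.assoc)
  ultimately show ?thesis
    unfolding bounded_multilinear_map_def multilinear_map_def by auto
qed

lemma bounded_multilinear_map_hd:
  assumes "bounded_multilinear_map (Suc k) m" "length vs = k"
  shows "m ((x + y) # vs) = m (x # vs) + m (y # vs)" "m ((r *\<^sub>R x) # vs) = r *\<^sub>R m (x # vs)"
proof -
  have "length [] + length vs + 1 = Suc k" using assms(2) by simp
  then have "linear (\<lambda>x. m ([] @ x # vs))"
    using assms(1) unfolding bounded_multilinear_map_def multilinear_map_def by blast
  then show "m ((x + y) # vs) = m (x # vs) + m (y # vs)" "m ((r *\<^sub>R x) # vs) = r *\<^sub>R m (x # vs)"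
    by (auto dest: linear_add linear_scale)
qed

lemma bounded_multilinear_map_bound:
  assumes "bounded_multilinear_map k m"
  obtains C where "C \<ge> 0" "\<And>vs. length vs = k \<Longrightarrow> norm (m vs) \<le> C * prod_list (map norm vs)"
proof -
  obtain C where C: "\<And>vs. length vs = k \<Longrightarrow> norm (m vs) \<le> C * prod_list (map norm vs)"
    using assms unfolding bounded_multilinear_map_def by blast
  have pos: "0 \<le> prod_list (map norm vs)" for vs :: "'a list"
    by (induction vs) auto
  show ?thesis
  proof (rule that[of "\<bar>C\<bar>"])
    show "norm (m vs) \<le> \<bar>C\<bar> * prod_list (map norm vs)" if "length vs = k" for vs
      using C[OF that] mult_right_mono[OF abs_ge_self pos, of C vs] by linarith
  qed simp
qed

lemma bounded_multilinear_map_1_blinfun: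
  assumes "bounded_multilinear_map 1 m"
  shows "\<exists>B :: 'a::real_normed_vector \<Rightarrow>\<^sub>L 'b::real_normed_vector. \<forall>u. B u = m [u]"
proof -
  obtain C where C: "C \<ge> 0" "\<And>vs. length vs = 1 \<Longrightarrow> norm (m vs) \<le> C * prod_list (map norm vs)"
    using bounded_multilinear_map_bound[OF assms] by blast
  have "bounded_linear (\<lambda>u. m [u])"
    using bounded_multilinear_map_hd[of 0 m "[]"] assms C(2)[of "[_]"]
    by (intro bounded_linear_intro[of _ C]) (auto simp: mult.commute)
  then show ?thesis
    by (metis bounded_linear_Blinfun_apply)
qed

text \<open>Currying: with the first argument fixed, the rest is a bounded operator whose norm is at
  most \<open>C\<close> times the norm of that argument. This norm estimate is where a nonnegative
  \<open>C\<close> matters.\<close>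

lemma bounded_multilinear_map_2_blinfun:
  assumes "bounded_multilinear_map 2 m"
  shows "\<exists>B :: 'a::real_normed_vector \<Rightarrow>\<^sub>L 'a \<Rightarrow>\<^sub>L 'b::real_normed_vector. \<forall>u v. B u v = m [u, v]"
proof -
  have m: "bounded_multilinear_map (Suc 1) m"
    using assms by (simp add: numeral_2_eq_2)
  obtain C where C: "C \<ge> 0" "\<And>vs. length vs = Suc 1 \<Longrightarrow> norm (m vs) \<le> C * prod_list (map norm vs)"
    using bounded_multilinear_map_bound[OF m] by blast
  obtain b :: "'a \<Rightarrow> 'a \<Rightarrow>\<^sub>L 'b" where b: "\<And>u v. b u v = m [u, v]"
    using bounded_multilinear_map_1_blinfun[OF bounded_multilinear_map_Suc[OF m]] by metis
  have "bounded_linear b"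
  proof (rule bounded_linear_intro[of _ C])
    show "norm (b u) \<le> norm u * C" for u
      using C(2)[of "[u, _]"] C(1)
      by (intro norm_blinfun_bound) (auto simp: b ac_simps)
  qed (auto intro!: blinfun_eqI simp: b blinfun.bilinear_simps bounded_multilinear_map_hd[OF m])
  then show ?thesis
    using b by (metis bounded_linear_Blinfun_apply)
qed

lemma bounded_multilinear_map_3_blinfun:
  assumes "bounded_multilinear_map 3 m"
  shows "\<exists>B :: 'a::real_normed_vector \<Rightarrow>\<^sub>L 'a \<Rightarrow>\<^sub>L 'a \<Rightarrow>\<^sub>L 'b::real_normed_vector.
    \<forall>u v w. B u v w = m [u, v, w]"
proof -
  have m: "bounded_multilinear_map (Suc 2) m"
    using assms by (simp add: eval_nat_numeral)
  obtain C where C: "C \<ge> 0" "\<And>vs. length vs = Suc 2 \<Longrightarrow> norm (m vs) \<le> C * prod_list (map norm vs)"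
    using bounded_multilinear_map_bound[OF m] by blast
  obtain b :: "'a \<Rightarrow> 'a \<Rightarrow>\<^sub>L 'a \<Rightarrow>\<^sub>L 'b" where b: "\<And>u v w. b u v w = m [u, v, w]"
    using bounded_multilinear_map_2_blinfun[OF bounded_multilinear_map_Suc[OF m]] by metis
  have "bounded_linear b"
  proof (rule bounded_linear_intro[of _ C])
    show "norm (b u) \<le> norm u * C" for u
      using C(2)[of "[u, _, _]"] C(1)
      by (intro norm_blinfun_bound) (auto simp: b ac_simps)
  qed (auto intro!: blinfun_eqI simp: b blinfun.bilinear_simps bounded_multilinear_map_hd[OF m])
  then show ?thesis
    using b by (metis bounded_linear_Blinfun_apply)
qed

text \<open>The estimate in \<open>smooth_on\<close> is uniform in \<open>vs\<close>, hence an
  estimate of operator norms: it says that the curried \<open>D (Suc k)\<close> is the Frechet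
  derivative of the curried \<open>D k\<close>.\<close>

lemma smooth_on_imp_has_C3_derivatives:
  fixes f :: "'a::real_normed_vector \<Rightarrow> 'b::real_normed_vector"
  assumes "smooth_on S f" "open S"
  shows "\<exists>f1 f2 f3. has_C3_derivatives S f f1 f2 f3"
proof -
  obtain D :: "nat \<Rightarrow> 'a \<Rightarrow> 'a list \<Rightarrow> 'b" where
    D0: "\<And>x. x \<in> S \<Longrightarrow> D 0 x [] = f x"
    and Dm: "\<And>k x. x \<in> S \<Longrightarrow> bounded_multilinear_map k (D k x)"
    and Dd: "\<And>k x e. x \<in> S \<Longrightarrow> e > 0 \<Longrightarrow> \<forall>\<^sub>F y in at x within S. \<forall>vs. length vs = k \<longrightarrow>
        norm (D k y vs - D k x vs - D (Suc k) x ((y - x) # vs))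
          \<le> e * norm (y - x) * prod_list (map norm vs)"
    using assms(1) unfolding smooth_on_def by blast
  have "\<forall>x\<in>S. \<exists>B :: 'a \<Rightarrow>\<^sub>L 'b. \<forall>u. B u = D 1 x [u]"
    using bounded_multilinear_map_1_blinfun[OF Dm] by blast
  from bchoice[OF this] obtain f1 where "\<forall>x\<in>S. \<forall>u. blinfun_apply (f1 x) u = D 1 x [u]"
    by blast
  note f1 = this[rule_format]
  have "\<forall>x\<in>S. \<exists>B :: 'a \<Rightarrow>\<^sub>L 'a \<Rightarrow>\<^sub>L 'b. \<forall>u v. B u v = D 2 x [u, v]"
    using bounded_multilinear_map_2_blinfun[OF Dm] by blast
  from bchoice[OF this] obtain f2 where "\<forall>x\<in>S. \<forall>u v. blinfun_apply (blinfun_apply (f2 x) u) v = D 2 x [u, v]"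
    by blast
  note f2 = this[rule_format]
  have "\<forall>x\<in>S. \<exists>B :: 'a \<Rightarrow>\<^sub>L 'a \<Rightarrow>\<^sub>L 'a \<Rightarrow>\<^sub>L 'b. \<forall>u v w. B u v w = D 3 x [u, v, w]"
    using bounded_multilinear_map_3_blinfun[OF Dm] by blast
  from bchoice[OF this] obtain f3 where "\<forall>x\<in>S. \<forall>u v w. blinfun_apply (blinfun_apply (blinfun_apply (f3 x) u) v) w = D 3 x [u, v, w]"
    by blast
  note f3 = this[rule_format]
  \<comment> \<open>Membership of \<open>y\<close> in \<open>S\<close> is recorded because
    \<open>f1\<close>, \<open>f2\<close>, \<open>f3\<close> agree with \<open>D\<close> only on
    \<open>S\<close>.\<close>
  have ev: "\<forall>\<^sub>F y in at x within S. y \<in> S \<and> (\<forall>vs. length vs = k \<longrightarrow>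
        norm (D k y vs - D k x vs - D (Suc k) x ((y - x) # vs))
          \<le> e * norm (y - x) * prod_list (map norm vs))" if "x \<in> S" "e > 0" for k x e
  proof (rule eventually_conj)
    show "\<forall>\<^sub>F y in at x within S. y \<in> S"
      by (simp add: eventually_at_filter)
  qed (rule Dd[OF that])
  have "(f has_derivative f1 x) (at x within S)" if "x \<in> S" for x
    unfolding has_derivative_within_alt2
  proof (intro conjI allI impI)
    fix e :: real assume "e > 0"
    show "\<forall>\<^sub>F y in at x within S. norm (f y - f x - f1 x (y - x)) \<le> e * norm (y - x)"
      by (rule eventually_mono[OF ev[OF that \<open>e > 0\<close>, of 0]]) (auto simp: D0 f1 that)
  qed (rule blinfun.bounded_linear_right)
  moreover have "(f1 has_derivative f2 x) (at x within S)" if "x \<in> S" for x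
    unfolding has_derivative_within_alt2
  proof (intro conjI allI impI)
    fix e :: real assume "e > 0"
    show "\<forall>\<^sub>F y in at x within S. norm (f1 y - f1 x - f2 x (y - x)) \<le> e * norm (y - x)"
    proof (rule eventually_mono[OF ev[OF that \<open>e > 0\<close>, of 1]])
      fix y assume y: "y \<in> S \<and> (\<forall>vs. length vs = 1 \<longrightarrow>
        norm (D 1 y vs - D 1 x vs - D (Suc 1) x ((y - x) # vs))
          \<le> e * norm (y - x) * prod_list (map norm vs))"
      show "norm (f1 y - f1 x - f2 x (y - x)) \<le> e * norm (y - x)"
        using y[THEN conjunct2, rule_format, of "[_]"] y \<open>e > 0\<close>
        by (intro norm_blinfun_bound) (auto simp: blinfun.diff_left f1 f2 that eval_nat_numeral)
    qed
  qed (rule blinfun.bounded_linear_right)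
  moreover have "(f2 has_derivative f3 x) (at x within S)" if "x \<in> S" for x
    unfolding has_derivative_within_alt2
  proof (intro conjI allI impI)
    fix e :: real assume "e > 0"
    show "\<forall>\<^sub>F y in at x within S. norm (f2 y - f2 x - f3 x (y - x)) \<le> e * norm (y - x)"
    proof (rule eventually_mono[OF ev[OF that \<open>e > 0\<close>, of 2]])
      fix y assume y: "y \<in> S \<and> (\<forall>vs. length vs = 2 \<longrightarrow>
        norm (D 2 y vs - D 2 x vs - D (Suc 2) x ((y - x) # vs))
          \<le> e * norm (y - x) * prod_list (map norm vs))"
      show "norm (f2 y - f2 x - f3 x (y - x)) \<le> e * norm (y - x)"
        using y[THEN conjunct2, rule_format, of "[_, _]"] y \<open>e > 0\<close>
        by (intro norm_blinfun_bound)
          (auto simp: blinfun.diff_left f2 f3 that eval_nat_numeral mult.assoc)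
    qed
  qed (rule blinfun.bounded_linear_right)
  \<comment> \<open>Continuity of \<open>f3\<close> comes from one more order: the estimate for
    \<open>D 3\<close> with error factor 1, together with the bound \<open>C\<close> on
    \<open>D 4 x\<close>, is a Lipschitz estimate at \<open>x\<close> with constant
    \<open>1 + C\<close>.\<close>
  moreover have "continuous (at x within S) f3" if xS: "x \<in> S" for x
  proof -
    obtain C where C: "C \<ge> 0" "\<And>vs. length vs = 4 \<Longrightarrow> norm (D 4 x vs) \<le> C * prod_list (map norm vs)"
      using bounded_multilinear_map_bound[OF Dm[OF xS]] by blast
    have "((\<lambda>y. (1 + C) * norm (y - x)) \<longlongrightarrow> 0) (at x within S)"
      by (auto intro!: tendsto_eq_intros)
    moreover have "\<forall>\<^sub>F y in at x within S. norm (f3 y - f3 x) \<le> (1 + C) * norm (y - x)"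
    proof (rule eventually_mono[OF ev[OF that zero_less_one, of 3]])
      fix y assume y: "y \<in> S \<and> (\<forall>vs. length vs = 3 \<longrightarrow>
        norm (D 3 y vs - D 3 x vs - D (Suc 3) x ((y - x) # vs))
          \<le> 1 * norm (y - x) * prod_list (map norm vs))"
      have "norm (D 3 y vs - D 3 x vs) \<le> (1 + C) * norm (y - x) * prod_list (map norm vs)"
        if "length vs = 3" for vs
      proof -
        have "norm (D 3 y vs - D 3 x vs) \<le> norm (D 3 y vs - D 3 x vs - D 4 x ((y - x) # vs))
            + norm (D 4 x ((y - x) # vs))"
          by (metis diff_add_cancel norm_triangle_ineq)
        also have "\<dots> \<le> 1 * norm (y - x) * prod_list (map norm vs) + C * (norm (y - x) * prod_list (map norm vs))"
          using y that C(2)[of "(y - x) # vs"] by (intro add_mono) (auto simp: eval_nat_numeral)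
        finally show ?thesis by (simp add: algebra_simps)
      qed
      from this[of "[_, _, _]"] show "norm (f3 y - f3 x) \<le> (1 + C) * norm (y - x)"
        using y C(1) by (intro norm_blinfun_bound)
          (auto simp: blinfun.diff_left f3 that mult.assoc)
    qed
    ultimately have "((\<lambda>y. f3 y - f3 x) \<longlongrightarrow> 0) (at x within S)"
      by (rule Lim_null_comparison[rotated])
    then show ?thesis
      by (simp add: continuous_within LIM_zero_iff)
  qed
  ultimately have "has_C3_derivatives S f f1 f2 f3"
    unfolding has_C3_derivatives_def has_C1_derivative_def continuous_on_eq_continuous_within
    using at_within_open[OF _ assms(2)] by (auto intro: has_derivative_continuous)
  then show ?thesis by blast
qed

section \<open>Derivatives along rays and the third-order Taylor formula\<close>

lemma has_C1_derivative_along_line: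
  assumes "has_C1_derivative S f f'" "t *\<^sub>R x \<in> S"
  shows "((\<lambda>t. f (t *\<^sub>R x)) has_vector_derivative f' (t *\<^sub>R x) x) (at t)"
proof -
  have "((\<lambda>t. t *\<^sub>R x) has_derivative (\<lambda>h. h *\<^sub>R x)) (at t)"
    by (auto intro!: derivative_eq_intros)
  moreover have "(f has_derivative f' (t *\<^sub>R x)) (at (t *\<^sub>R x))"
    using assms unfolding has_C1_derivative_def by blast
  ultimately have "((\<lambda>t. f (t *\<^sub>R x)) has_derivative (\<lambda>h. f' (t *\<^sub>R x) (h *\<^sub>R x))) (at t)"
    by (rule has_derivative_compose)
  then show ?thesis
    by (simp add: has_vector_derivative_def blinfun.scaleR_right)
qed

lemma has_C3_derivatives_along_line:
  assumes "has_C3_derivatives S f f1 f2 f3" "t *\<^sub>R x \<in> S"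
  shows "((\<lambda>t. f (t *\<^sub>R x)) has_vector_derivative f1 (t *\<^sub>R x) x) (at t)"
    and "((\<lambda>t. f1 (t *\<^sub>R x) x) has_vector_derivative f2 (t *\<^sub>R x) x x) (at t)"
    and "((\<lambda>t. f2 (t *\<^sub>R x) x x) has_vector_derivative f3 (t *\<^sub>R x) x x x) (at t)"
proof -
  note 1 = assms[unfolded has_C3_derivatives_def]
  show "((\<lambda>t. f (t *\<^sub>R x)) has_vector_derivative f1 (t *\<^sub>R x) x) (at t)"
    using 1 has_C1_derivative_along_line by blast
  have "((\<lambda>t. f1 (t *\<^sub>R x)) has_vector_derivative f2 (t *\<^sub>R x) x) (at t)"
    using 1 has_C1_derivative_along_line by blast
  then show "((\<lambda>t. f1 (t *\<^sub>R x) x) has_vector_derivative f2 (t *\<^sub>R x) x x) (at t)"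
    by (rule bounded_linear.has_vector_derivative[OF blinfun.bounded_linear_left])
  have "((\<lambda>t. f2 (t *\<^sub>R x)) has_vector_derivative f3 (t *\<^sub>R x) x) (at t)"
    using 1 has_C1_derivative_along_line by blast
  then show "((\<lambda>t. f2 (t *\<^sub>R x) x x) has_vector_derivative f3 (t *\<^sub>R x) x x x) (at t)"
    by (intro bounded_linear.has_vector_derivative[OF blinfun.bounded_linear_left])
qed

lemma norm_le_of_vector_derivative_bound:
  fixes r :: "real \<Rightarrow> 'b::real_normed_vector"
  assumes "\<And>t. t \<in> {0..1} \<Longrightarrow> (r has_vector_derivative r' t) (at t)"
    and "\<And>t. t \<in> {0..1} \<Longrightarrow> norm (r' t) \<le> B" and "r 0 = 0" and t: "t \<in> {0..1}"
  shows "norm (r t) \<le> B"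
proof -
  have B: "0 \<le> B" using assms(2)[OF t] norm_ge_zero order_trans by blast
  have "norm (r t - r 0) \<le> B * norm (t - 0)"
  proof (rule differentiable_bound[of "{0..1}" r "\<lambda>t h. h *\<^sub>R r' t"])
    show "(r has_derivative (\<lambda>h. h *\<^sub>R r' s)) (at s within {0..1})" if "s \<in> {0..1}" for s
      using assms(1)[OF that] unfolding has_vector_derivative_def by (rule has_derivative_at_withinI)
    show "onorm (\<lambda>h. h *\<^sub>R r' s) \<le> B" if "s \<in> {0..1}" for s
      using assms(2)[OF that] B by (intro onorm_bound) (auto simp: mult.commute[of B] intro!: mult_left_mono)
  qed (use t in auto)
  also have "\<dots> \<le> B * 1" using t B by (intro mult_left_mono) auto
  finally show ?thesis using assms(3) by simp
qed

lemma norm_blinfun3: "norm (blinfun_apply (blinfun_apply (blinfun_apply T x) y) z) \<le> norm T * norm x * norm y * norm z"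
  by (rule order_trans[OF norm_blinfun mult_right_mono[OF order_trans[OF norm_blinfun
        mult_right_mono[OF norm_blinfun norm_ge_zero]] norm_ge_zero]])

text \<open>The mean value inequality is applied three times along the ray through \<open>x\<close>;
  near 0 the innermost remainder is at most \<open>e * norm x ^ 3\<close> by continuity of
  \<open>G3\<close>.\<close>

lemma has_C3_derivatives_taylor:
  fixes G :: "'a::real_normed_vector \<Rightarrow> 'b::real_normed_vector"
  assumes G: "has_C3_derivatives S G G1 G2 G3" and "open S" "0 \<in> S" "e > 0"
  shows "\<exists>d>0. \<forall>x. norm x < d \<longrightarrow>
    norm (G x - (G 0 + G1 0 x + (1/2) *\<^sub>R G2 0 x x + (1/6) *\<^sub>R G3 0 x x x)) \<le> e * norm x ^ 3"
proof -
  obtain d0 where d0: "d0 > 0" "ball 0 d0 \<subseteq> S"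
    using assms by (meson openE)
  have "continuous_on S G3"
    using G unfolding has_C3_derivatives_def has_C1_derivative_def by blast
  then obtain d1 where d1: "d1 > 0" "\<And>x. x \<in> S \<Longrightarrow> norm x < d1 \<Longrightarrow> norm (G3 x - G3 0) < e"
    using assms(3,4) unfolding continuous_on_iff dist_norm by (metis diff_zero)
  have "norm (G x - (G 0 + G1 0 x + (1/2) *\<^sub>R G2 0 x x + (1/6) *\<^sub>R G3 0 x x x)) \<le> e * norm x ^ 3"
    if x: "norm x < min d0 d1" for x
  proof -
    have small: "norm (t *\<^sub>R x) < min d0 d1" if "t \<in> {0..1}" for t
      using mult_right_mono[of t 1 "norm x"] that x by (auto intro: le_less_trans)
    then have S: "t *\<^sub>R x \<in> S" if "t \<in> {0..1}" for t
      using d0 that by (auto simp: subset_iff)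
    \<comment> \<open>Taylor remainders along the ray: \<open>r0\<close> has derivative
      \<open>r1\<close>, \<open>r1\<close> has derivative \<open>r2\<close>, and the derivative of
      \<open>r2\<close> is the increment of \<open>G3\<close>. All three vanish at
      \<open>t = 0\<close>, so on the unit interval one and the same bound passes from each to the
      next.\<close>
    define r2 where "r2 t = G2 (t *\<^sub>R x) x x - G2 0 x x - t *\<^sub>R G3 0 x x x" for t
    define r1 where "r1 t = G1 (t *\<^sub>R x) x - G1 0 x - t *\<^sub>R G2 0 x x - (t^2/2) *\<^sub>R G3 0 x x x" for t
    define r0 where "r0 t = G (t *\<^sub>R x) - G 0 - t *\<^sub>R G1 0 x - (t^2/2) *\<^sub>R G2 0 x x - (t^3/6) *\<^sub>R G3 0 x x x" for t
    note lines = has_C3_derivatives_along_line[OF G S]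
    have r3: "norm (G3 (t *\<^sub>R x) x x x - G3 0 x x x) \<le> e * norm x ^ 3" if t: "t \<in> {0..1}" for t
    proof -
      have "norm ((G3 (t *\<^sub>R x) - G3 0) x x x) \<le> norm (G3 (t *\<^sub>R x) - G3 0) * norm x * norm x * norm x"
        by (rule norm_blinfun3)
      also have "\<dots> \<le> e * norm x * norm x * norm x"
        using d1(2)[OF S[OF t]] small[OF t] by (intro mult_right_mono) auto
      finally show ?thesis by (simp add: blinfun.bilinear_simps power3_eq_cube mult.assoc)
    qed
    have "norm (r2 t) \<le> e * norm x ^ 3" if "t \<in> {0..1}" for t
      by (rule norm_le_of_vector_derivative_bound[OF _ r3 _ that])
        (auto simp: r2_def intro!: derivative_eq_intros lines)
    then have "norm (r1 t) \<le> e * norm x ^ 3" if "t \<in> {0..1}" for t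
      by (rule norm_le_of_vector_derivative_bound[where r = r1, OF _ _ _ that, rotated])
        (auto simp: r1_def[abs_def] r2_def intro!: derivative_eq_intros lines)
    then have "norm (r0 t) \<le> e * norm x ^ 3" if "t \<in> {0..1}" for t
      by (rule norm_le_of_vector_derivative_bound[where r = r0, OF _ _ _ that, rotated])
        (auto simp: r0_def[abs_def] r1_def power2_eq_square intro!: derivative_eq_intros lines)
    from this[of 1] show ?thesis by (simp add: r0_def algebra_simps)
  qed
  then show ?thesis
    using d0 d1 by (intro exI[of _ "min d0 d1"]) auto
qed

lemma ndiff0_eq:
  assumes G: "has_C3_derivatives S G G1 G2 G3" and "open S" "0 \<in> S"
  shows "ndiff0 2 G v = G2 0 v v" "ndiff0 3 G v = G3 0 v v v"
proof -
  \<comment> \<open>The times at which the ray stays in \<open>S\<close>. The formulas for the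
    iterated derivatives hold on this open set, and locality of the derivative lets each be
    differentiated again.\<close>
  define I where "I = {t::real. t *\<^sub>R v \<in> S}"
  have "open ((\<lambda>t::real. t *\<^sub>R v) -` S)"
    by (rule open_vimage[OF assms(2)]) (auto intro!: continuous_intros)
  then have I: "open I" "0 \<in> I"
    using assms(3) by (auto simp: I_def vimage_def)
  note lines = has_C3_derivatives_along_line[OF G]
  have 1: "vector_derivative (\<lambda>t. G (t *\<^sub>R v)) (at t) = G1 (t *\<^sub>R v) v" if "t \<in> I" for t
    using lines(1) that by (auto simp: I_def intro: vector_derivative_at)
  have 2: "vector_derivative (\<lambda>t. vector_derivative (\<lambda>t. G (t *\<^sub>R v)) (at t)) (at t) = G2 (t *\<^sub>R v) v v"
    if "t \<in> I" for t
    using lines(2)[of t v] that has_vector_derivative_transform_within_open[OF _ I(1) that 1[symmetric]]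
    by (auto simp: I_def intro: vector_derivative_at)
  have 3: "vector_derivative (\<lambda>t. vector_derivative (\<lambda>t. vector_derivative (\<lambda>t. G (t *\<^sub>R v)) (at t)) (at t)) (at 0)
      = G3 0 v v v"
    using lines(3)[of 0 v] I has_vector_derivative_transform_within_open[OF _ I 2[symmetric]]
    by (auto simp: I_def intro: vector_derivative_at)
  show "ndiff0 2 G v = G2 0 v v" "ndiff0 3 G v = G3 0 v v v"
    using 2[of 0] 3 I(2) by (simp_all add: ndiff0_def eval_nat_numeral)
qed

lemma diff0_eq:
  assumes "has_C3_derivatives S G G1 G2 G3" "0 \<in> S"
  shows "diff0 G = G1 0"
  using assms unfolding has_C3_derivatives_def has_C1_derivative_def diff0_def
  by (metis frechet_derivative_at)

section \<open>Polarization and the symmetric differentials\<close>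

lemma symmetric_bilinear_polarization:
  fixes T :: "'a::real_vector \<Rightarrow> 'a \<Rightarrow> 'b::real_vector"
  assumes comm: "\<And>x y. T x y = T y x" and add: "\<And>x y z. T (x + y) z = T x z + T y z"
  shows "2 *\<^sub>R T x y = T (x + y) (x + y) - T x x - T y y"
proof -
  have "T z (x + y) = T z x + T z y" for x y z
    using add[of x y z] comm by metis
  then show ?thesis
    using comm[of y x] by (simp add: add scaleR_2)
qed

lemma scaleR_6: "6 *\<^sub>R t = t + t + t + t + t + t" for t :: "'a::real_vector"
proof -
  have "6 *\<^sub>R t = (1 + 1 + 1 + 1 + 1 + 1) *\<^sub>R t" by simp
  then show ?thesis by (simp only: scaleR_left.add scaleR_one)
qed

text \<open>Inclusion-exclusion over the three arguments: in the alternating sum of cubes only the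
  six mixed terms survive, and symmetry makes them equal.\<close>

lemma symmetric_trilinear_polarization:
  fixes T :: "'a::real_vector \<Rightarrow> 'a \<Rightarrow> 'a \<Rightarrow> 'b::real_vector"
  assumes comm: "\<And>x y z. T x y z = T y x z" "\<And>x y z. T x y z = T x z y"
    and add: "\<And>x x' y z. T (x + x') y z = T x y z + T x' y z"
  shows "6 *\<^sub>R T x y z = T (x + y + z) (x + y + z) (x + y + z)
    - T (x + y) (x + y) (x + y) - T (y + z) (y + z) (y + z) - T (x + z) (x + z) (x + z)
    + T x x x + T y y y + T z z z"
proof -
  have add2: "T z (x + y) w = T z x w + T z y w" for x y z w
    using add[of x y z w] comm(1) by metis
  have add3: "T z w (x + y) = T z w x + T z w y" for x y z w
    using add2[of z x y w] comm(2) by metis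
  have "T x z y = T x y z" "T y x z = T x y z" "T y z x = T x y z" "T z x y = T x y z" "T z y x = T x y z"
    using comm by metis+
  then show ?thesis
    unfolding scaleR_6 by (simp add: add add2 add3)
qed

lemma length_2E:
  assumes "length vs = 2"
  obtains a b where "vs = [a, b]"
  using assms by (auto simp: eval_nat_numeral length_Suc_conv)

lemma length_3E:
  assumes "length vs = 3"
  obtains a b c where "vs = [a, b, c]"
  using assms by (auto simp: eval_nat_numeral length_Suc_conv)

lemma multilinear_map_add_hd:
  assumes "multilinear_map (Suc k) m" "length vs = k"
  shows "m ((x + y) # vs) = m (x # vs) + m (y # vs)"
proof -
  have "length [] + length vs + 1 = Suc k" using assms(2) by simp
  then have "linear (\<lambda>x. m ([] @ x # vs))"
    using assms(1) unfolding multilinear_map_def by blast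
  then show ?thesis
    by (auto dest: linear_add)
qed

lemma symmetric_multilinear_2_unique:
  assumes "multilinear_map 2 m" "symmetric_map 2 m" "multilinear_map 2 m'" "symmetric_map 2 m'"
    and diag: "\<And>v. m (replicate 2 v) = m' (replicate 2 v)" and "length vs = 2"
  shows "m vs = m' vs"
proof -
  obtain x y where vs: "vs = [x, y]" using assms(6) by (rule length_2E)
  have pol: "2 *\<^sub>R n [x, y] = n [x + y, x + y] - n [x, x] - n [y, y]"
    if "multilinear_map 2 n" "symmetric_map 2 n" for n
    using that multilinear_map_add_hd[of 1 n] unfolding symmetric_map_def
    by (intro symmetric_bilinear_polarization[where T = "\<lambda>x y. n [x, y]"])
      (auto simp: numeral_2_eq_2)
  have "m [v, v] = m' [v, v]" for v
    using diag[of v] by (simp add: numeral_2_eq_2)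
  then have "2 *\<^sub>R m [x, y] = 2 *\<^sub>R m' [x, y]"
    using pol[OF assms(1,2)] pol[OF assms(3,4)] by metis
  then show ?thesis using vs by simp
qed

lemma symmetric_multilinear_3_unique:
  assumes "multilinear_map 3 m" "symmetric_map 3 m" "multilinear_map 3 m'" "symmetric_map 3 m'"
    and diag: "\<And>v. m (replicate 3 v) = m' (replicate 3 v)" and "length vs = 3"
  shows "m vs = m' vs"
proof -
  obtain x y z where vs: "vs = [x, y, z]" using assms(6) by (rule length_3E)
  have pol: "6 *\<^sub>R n [x, y, z] = n [x + y + z, x + y + z, x + y + z]
    - n [x + y, x + y, x + y] - n [y + z, y + z, y + z] - n [x + z, x + z, x + z]
    + n [x, x, x] + n [y, y, y] + n [z, z, z]"
    if "multilinear_map 3 n" "symmetric_map 3 n" for n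
    using that multilinear_map_add_hd[of 2 n] unfolding symmetric_map_def
    by (intro symmetric_trilinear_polarization[where T = "\<lambda>x y z. n [x, y, z]"])
      (auto simp: eval_nat_numeral)
  have "m [v, v, v] = m' [v, v, v]" for v
    using diag[of v] by (simp add: eval_nat_numeral)
  then have "6 *\<^sub>R m [x, y, z] = 6 *\<^sub>R m' [x, y, z]"
    using pol[OF assms(1,2)] pol[OF assms(3,4)] by metis
  then show ?thesis using vs by simp
qed

section \<open>Explicit form of the symmetric differentials\<close>

text \<open>The symmetrization of \<open>Q\<close> is symmetric, bilinear and has the diagonal of
  \<open>Q\<close>; by polarization it is the only such map, so it is the value of the definite
  description. Mixed terms therefore appear below as sums over the orders of the arguments.\<close>

lemma ndiff0_multi_2_eq:
  assumes "\<And>v. ndiff0 2 G v = blinfun_apply (blinfun_apply Q v) v"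
  shows "ndiff0_multi 2 G [v, w] = (1/2) *\<^sub>R (Q v w + Q w v)"
proof -
  define m where "m vs = (case vs of [v, w] \<Rightarrow> (1/2) *\<^sub>R (Q v w + Q w v) | _ \<Rightarrow> 0)" for vs
  have m: "m [v, w] = (1/2) *\<^sub>R (Q v w + Q w v)" for v w
    by (simp add: m_def)
  have lin: "multilinear_map 2 m"
    unfolding multilinear_map_def
  proof (intro allI impI)
    fix us vs :: "'a list" assume "length us + length vs + 1 = 2"
    then consider a where "us = []" "vs = [a]" | a where "us = [a]" "vs = []"
      by (cases us; cases vs) auto
    then show "linear (\<lambda>x. m (us @ x # vs))"
      by cases (auto intro!: linearI simp: m blinfun.bilinear_simps algebra_simps)
  qed
  have sym: "symmetric_map 2 m"
    unfolding symmetric_map_def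
  proof (intro allI impI)
    fix vs ws :: "'a list" assume vs: "length vs = 2" "mset vs = mset ws"
    then have "length ws = 2" by (metis size_mset)
    then show "m vs = m ws"
      using vs by (elim length_2E) (auto simp: m add.commute add_eq_conv_ex)
  qed
  have diag: "m (replicate 2 v) = ndiff0 2 G v" for v
  proof -
    have "replicate 2 v = [v, v]" by (simp add: numeral_2_eq_2)
    then show ?thesis by (simp add: assms m flip: scaleR_2)
  qed
  have zero: "m vs = 0" if "length vs \<noteq> 2" for vs
    using that by (auto simp: m_def split: list.splits)
  have "ndiff0_multi 2 G = m"
    unfolding ndiff0_multi_def
  proof (rule the_equality)
    fix n assume n: "multilinear_map 2 n \<and> symmetric_map 2 n \<and>
      (\<forall>v. n (replicate 2 v) = ndiff0 2 G v) \<and> (\<forall>vs. length vs \<noteq> 2 \<longrightarrow> n vs = 0)"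
    show "n = m"
    proof
      fix vs show "n vs = m vs"
        using symmetric_multilinear_2_unique[OF _ _ lin sym, of n vs] n diag zero
        by (cases "length vs = 2") auto
    qed
  qed (use lin sym diag zero in blast)
  then show ?thesis by (simp add: m)
qed

lemma ndiff0_multi_3_eq:
  assumes "\<And>v. ndiff0 3 G v = blinfun_apply (blinfun_apply (blinfun_apply C v) v) v"
  shows "ndiff0_multi 3 G [u, v, w] =
    (1/6) *\<^sub>R (C u v w + C u w v + C v u w + C v w u + C w u v + C w v u)"
proof -
  define m where "m vs = (case vs of [u, v, w] \<Rightarrow>
    (1/6) *\<^sub>R (C u v w + C u w v + C v u w + C v w u + C w u v + C w v u) | _ \<Rightarrow> 0)" for vs
  have m: "m [u, v, w] = (1/6) *\<^sub>R (C u v w + C u w v + C v u w + C v w u + C w u v + C w v u)" for u v w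
    by (simp add: m_def)
  have lin: "multilinear_map 3 m"
    unfolding multilinear_map_def
  proof (intro allI impI)
    fix us vs :: "'a list" assume "length us + length vs + 1 = 3"
    then consider a b where "us = []" "vs = [a, b]" | a b where "us = [a]" "vs = [b]"
      | a b where "us = [a, b]" "vs = []"
      by (cases us; cases vs; cases "tl us"; cases "tl vs") auto
    then show "linear (\<lambda>x. m (us @ x # vs))"
      by cases (auto intro!: linearI simp: m blinfun.bilinear_simps algebra_simps)
  qed
  have sym: "symmetric_map 3 m"
    unfolding symmetric_map_def
  proof (intro allI impI)
    fix vs ws :: "'a list" assume vs: "length vs = 3" "mset vs = mset ws"
    then have "length ws = 3" by (metis size_mset)
    then show "m vs = m ws"
      using vs by (elim length_3E) (auto simp: m algebra_simps add_eq_conv_ex)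
  qed
  have diag: "m (replicate 3 v) = ndiff0 3 G v" for v
  proof -
    have "replicate 3 v = [v, v, v]" by (simp add: eval_nat_numeral)
    moreover have "t + t + t + t + t + t = 6 *\<^sub>R t" for t :: 'b
      by (rule scaleR_6[symmetric])
    ultimately show ?thesis by (simp add: assms m)
  qed
  have zero: "m vs = 0" if "length vs \<noteq> 3" for vs
    using that by (auto simp: m_def split: list.splits)
  have "ndiff0_multi 3 G = m"
    unfolding ndiff0_multi_def
  proof (rule the_equality)
    fix n assume n: "multilinear_map 3 n \<and> symmetric_map 3 n \<and>
      (\<forall>v. n (replicate 3 v) = ndiff0 3 G v) \<and> (\<forall>vs. length vs \<noteq> 3 \<longrightarrow> n vs = 0)"
    show "n = m"
    proof
      fix vs show "n vs = m vs"
        using symmetric_multilinear_3_unique[OF _ _ lin sym, of n vs] n diag zero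
        by (cases "length vs = 3") auto
    qed
  qed (use lin sym diag zero in blast)
  then show ?thesis by (simp add: m)
qed

section \<open>Openness from a third-order model\<close>

text \<open>A solution of \<open>f y = t\<close> is a fixed point of \<open>y - f y + t\<close>.
  This map sends the ball of radius \<open>r\<close> to itself, since each of \<open>y - f y\<close>
  and \<open>t\<close> has norm at most \<open>r / 2\<close>, and Brouwer's theorem applies.\<close>

lemma cball_subset_image_near_identity:
  fixes f :: "'e::euclidean_space \<Rightarrow> 'e"
  assumes "r > 0" "continuous_on (cball 0 r) f" "\<And>y. y \<in> cball 0 r \<Longrightarrow> norm (f y - y) \<le> r / 2"
  shows "cball 0 (r / 2) \<subseteq> f ` cball 0 r"
proof
  fix t :: 'e assume t: "t \<in> cball 0 (r / 2)"
  have "norm (y - f y + t) \<le> r" if "y \<in> cball 0 r" for y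
    using norm_triangle_ineq[of "y - f y" t] assms(3)[OF that] t by (simp add: norm_minus_commute)
  then have "(\<lambda>y. y - f y + t) \<in> cball 0 r \<rightarrow> cball 0 r" by auto
  moreover have "continuous_on (cball 0 r) (\<lambda>y. y - f y + t)"
    by (intro continuous_intros assms(2))
  ultimately obtain y where "y \<in> cball 0 r" "y - f y + t = y"
    using brouwer_ball[OF assms(1), of 0 "\<lambda>y. y - f y + t"] by blast
  then show "t \<in> f ` cball 0 r" by (auto simp: algebra_simps)
qed

text \<open>By \<open>S(2)\<close>, \<open>L\<close> after \<open>S\<close> is a projection onto the
  range of \<open>L\<close>, with complement \<open>\<pi>\<close>. The hypothesis
  \<open>near\<close> concerns only the \<open>\<pi>\<close>-part of the limit model, because the
  other part is solved exactly through \<open>z\<close>.\<close>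

lemma open_at_zero_of_third_order_model:
  fixes G :: "'a::real_normed_vector \<Rightarrow> 'e::euclidean_space"
    and L :: "'a \<Rightarrow>\<^sub>L 'e" and Q :: "'a \<Rightarrow>\<^sub>L 'a \<Rightarrow>\<^sub>L 'e" and C :: "'a \<Rightarrow>\<^sub>L 'a \<Rightarrow>\<^sub>L 'a \<Rightarrow>\<^sub>L 'e"
    and a k :: "'e \<Rightarrow> 'a" and S :: "'e \<Rightarrow> 'a"
  defines "\<pi> \<equiv> \<lambda>y. y - L (S y)"
  assumes taylor: "\<And>e. e > 0 \<Longrightarrow> \<exists>d>0. \<forall>x. norm x < d \<longrightarrow>
      norm (G x - (L x + (1/2) *\<^sub>R Q x x + (1/6) *\<^sub>R C x x x)) \<le> e * norm x ^ 3"
    and G: "continuous_on N G" "open N" "0 \<in> N"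
    and S: "linear S" "\<And>x. L (S (L x)) = L x"
    and w: "L w = 0" "Q w w \<in> range L"
    and r: "r > 0"
    and ak: "continuous_on (cball 0 r) a" "continuous_on (cball 0 r) k"
    and a: "\<And>y. y \<in> cball 0 r \<Longrightarrow> L (a y) = 0"
      "\<And>x y. y \<in> cball 0 r \<Longrightarrow> Q (a y) x + Q x (a y) \<in> range L"
    and k: "\<And>y. y \<in> cball 0 r \<Longrightarrow> L (k y) = 0"
    and near: "\<And>y. y \<in> cball 0 r \<Longrightarrow>
      norm (\<pi> ((1/2) *\<^sub>R (Q w (k y) + Q (k y) w) + (1/6) *\<^sub>R C (a y) (a y) (a y)) - \<pi> y) \<le> r / 4"
    and V: "open V" "0 \<in> V"
  shows "0 \<in> interior (G ` V)"
proof -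
  define P where "P y = L (S y)" for y
  \<comment> \<open>\<open>S\<close> starts from the finite-dimensional target space, so linearity
    already gives boundedness.\<close>
  have bS: "bounded_linear S"
    using S(1) by (simp add: linear_conv_bounded_linear)
  have bP: "bounded_linear P"
    unfolding P_def by (intro bounded_linear_compose[OF blinfun.bounded_linear_right bS])
  have b\<pi>: "bounded_linear \<pi>"
    using bounded_linear_sub[OF bounded_linear_ident bP] by (simp add: \<pi>_def P_def)
  interpret P: bounded_linear P by (rule bP)
  interpret \<pi>: bounded_linear \<pi> by (rule b\<pi>)
  have PL: "P (L x) = L x" for x by (simp add: P_def S(2))
  have \<pi>L: "\<pi> (L x) = 0" for x by (simp add: \<pi>_def S(2))
  have \<pi>range: "\<pi> y = 0" if "y \<in> range L" for y using that \<pi>L by auto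
  have PP: "P (P y) = P y" and \<pi>P: "\<pi> (P y) = 0" for y using PL \<pi>L by (auto simp: P_def)
  have split: "P y + \<pi> y = y" for y by (simp add: \<pi>_def P_def)
  have P\<pi>: "P (\<pi> y) = 0" for y using split[of y] PP P.add by (metis add_cancel_left_right)
  have \<pi>\<pi>: "\<pi> (\<pi> y) = \<pi> y" for y using split[of "\<pi> y"] P\<pi> by simp

  \<comment> \<open>Chosen so that
    \<open>L (z y) + P ((1/2) *\<^sub>R Q (a y) (a y)) = P y\<close>.\<close>
  define z where "z y = S (y - (1/2) *\<^sub>R Q (a y) (a y))" for y
  define q where "q s y = s *\<^sub>R w + s ^ 3 *\<^sub>R k y + s ^ 4 *\<^sub>R z y" for s y
  define p where "p s y = a y + q s y" for s y
  \<comment> \<open>What remains of \<open>Q (q s y) (q s y)\<close> after removing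
    \<open>s ^ 2 *\<^sub>R Q w w\<close> and dividing by \<open>s ^ 4\<close>.\<close>
  define R where "R s y = (Q w (k y) + Q (k y) w) + s *\<^sub>R (Q w (z y) + Q (z y) w) + s ^ 2 *\<^sub>R Q (k y) (k y)
    + s ^ 3 *\<^sub>R (Q (k y) (z y) + Q (z y) (k y)) + s ^ 4 *\<^sub>R Q (z y) (z y)" for s y
  \<comment> \<open>The Taylor polynomial at \<open>s ^ 4 *\<^sub>R p s y\<close> after the
    anisotropic rescaling, written without division so that it makes sense and is continuous at
    \<open>s = 0\<close>. For \<open>s > 0\<close>, \<open>\<delta> s\<close> is the rescaling
    itself.\<close>
  define \<Psi> where "\<Psi> s y = L (z y) + P ((1/2) *\<^sub>R Q (p s y) (p s y))
    + s ^ 4 *\<^sub>R P ((1/6) *\<^sub>R C (p s y) (p s y) (p s y))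
    + \<pi> ((1/2) *\<^sub>R R s y + (1/6) *\<^sub>R C (p s y) (p s y) (p s y))" for s y
  define \<delta> where "\<delta> s v = (1 / s ^ 8) *\<^sub>R P v + (1 / s ^ 12) *\<^sub>R \<pi> v" for s :: real and v

  \<comment> \<open>On the \<open>P\<close>-side, \<open>L\<close> sees only \<open>z\<close>, which
    yields \<open>s ^ 8\<close>. On the \<open>\<pi>\<close>-side, the quadratic terms involving
    \<open>a\<close> vanish by the second part of \<open>a\<close>, and \<open>Q w w\<close> lies in
    the range of \<open>L\<close>; the rest of the quadratic term gains \<open>s ^ 4\<close> and
    meets the cubic one at \<open>s ^ 12\<close>.\<close>
  have model: "L (s ^ 4 *\<^sub>R p s y) + (1/2) *\<^sub>R Q (s ^ 4 *\<^sub>R p s y) (s ^ 4 *\<^sub>R p s y)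
      + (1/6) *\<^sub>R C (s ^ 4 *\<^sub>R p s y) (s ^ 4 *\<^sub>R p s y) (s ^ 4 *\<^sub>R p s y)
      = s ^ 8 *\<^sub>R P (\<Psi> s y) + s ^ 12 *\<^sub>R \<pi> (\<Psi> s y)" (is "?T = _")
    if y: "y \<in> cball 0 r" for s y
  proof -
    have Lp: "L (p s y) = s ^ 4 *\<^sub>R L (z y)"
      by (simp add: p_def q_def blinfun.bilinear_simps a(1)[OF y] k[OF y] w(1))
    have T: "?T = s ^ 8 *\<^sub>R L (z y) + s ^ 8 *\<^sub>R ((1/2) *\<^sub>R Q (p s y) (p s y))
        + s ^ 12 *\<^sub>R ((1/6) *\<^sub>R C (p s y) (p s y) (p s y))"
      by (simp add: blinfun.scaleR_right blinfun.scaleR_left Lp flip: power_add)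
    have PT: "P ?T = s ^ 8 *\<^sub>R P (\<Psi> s y)"
      unfolding T by (simp add: \<Psi>_def P.add P.scaleR PL PP P\<pi> scaleR_add_right flip: power_add)
    have Qq: "Q (q s y) (q s y) = s ^ 2 *\<^sub>R Q w w + s ^ 4 *\<^sub>R R s y"
      by (simp add: q_def R_def blinfun.bilinear_simps scaleR_add_right
          flip: power_add power_Suc power_Suc2 power2_eq_square)
    \<comment> \<open>The summand \<open>u\<close> is left unsplit: of the two cross terms between
      \<open>a\<close> and \<open>q\<close>, only the sum is known to be killed by
      \<open>\<pi>\<close>.\<close>
    have \<pi>add4: "\<pi> (t + u + (v + x)) = \<pi> t + \<pi> u + (\<pi> v + \<pi> x)" for t u v x
      by (simp add: \<pi>.add)
    have Qa: "\<pi> (Q (a y) x + Q x (a y)) = 0" for x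
      using \<pi>range[OF a(2)[OF y]] .
    have "\<pi> (Q (a y) (a y)) = 0"
      using Qa[of "a y"] by (simp add: \<pi>.scaleR flip: scaleR_2)
    moreover have "Q (p s y) (p s y) = Q (a y) (a y) + (Q (a y) (q s y) + Q (q s y) (a y)) + Q (q s y) (q s y)"
      by (simp add: p_def blinfun.add_left blinfun.add_right)
    ultimately have "\<pi> (Q (p s y) (p s y)) = s ^ 4 *\<^sub>R \<pi> (R s y)"
      using \<pi>add4 by (simp only: Qq Qa \<pi>.scaleR \<pi>range[OF w(2)]) simp
    then have \<pi>T: "\<pi> ?T = s ^ 12 *\<^sub>R \<pi> (\<Psi> s y)"
      unfolding T by (simp add: \<Psi>_def \<pi>.add \<pi>.scaleR \<pi>L \<pi>P \<pi>\<pi> scaleR_add_right flip: power_add)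
    show ?thesis using split[of ?T] PT \<pi>T by metis
  qed

  have \<Psi>0: "norm (\<Psi> 0 y - y) \<le> r / 4" if y: "y \<in> cball 0 r" for y
  proof -
    have "\<Psi> 0 y = P y + \<pi> ((1/2) *\<^sub>R (Q w (k y) + Q (k y) w) + (1/6) *\<^sub>R C (a y) (a y) (a y))"
      by (simp add: \<Psi>_def R_def p_def q_def z_def P.diff flip: P_def)
    then have "\<Psi> 0 y - y = \<pi> ((1/2) *\<^sub>R (Q w (k y) + Q (k y) w) + (1/6) *\<^sub>R C (a y) (a y) (a y)) - \<pi> y"
      using split[of y] by (metis add_diff_cancel_left)
    then show ?thesis using near[OF y] by simp
  qed

  \<comment> \<open>Compactness with \<open>s = 0\<close> included gives uniform bounds on
    \<open>p\<close> and convergence of \<open>\<Psi> s\<close> to \<open>\<Psi> 0\<close> uniformly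
    in \<open>y\<close>.\<close>
  define K where "K = {0..1::real} \<times> cball (0::'e) r"
  have K: "compact K" unfolding K_def by (intro compact_Times) auto
  have "continuous_on K (\<lambda>x. f (snd x))" if "continuous_on (cball 0 r) f" for f :: "'e \<Rightarrow> 'a"
    by (rule continuous_on_compose2[OF that]) (auto simp: K_def intro!: continuous_intros)
  moreover have zc: "continuous_on (cball 0 r) z"
    unfolding z_def by (intro bounded_linear.continuous_on[OF bS] continuous_intros ak)
  ultimately have akz: "continuous_on K (\<lambda>x. a (snd x))" "continuous_on K (\<lambda>x. k (snd x))"
      "continuous_on K (\<lambda>x. z (snd x))"
    using ak by blast+
  have pc: "continuous_on K (\<lambda>x. p (fst x) (snd x))"
    unfolding p_def q_def by (intro continuous_intros akz)
  have \<Psi>c: "continuous_on K (\<lambda>x. \<Psi> (fst x) (snd x))"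
    unfolding \<Psi>_def R_def
    by (intro continuous_intros P.continuous_on \<pi>.continuous_on akz pc)
  obtain M where M: "M > 0" "\<And>s y. s \<in> {0..1} \<Longrightarrow> y \<in> cball 0 r \<Longrightarrow> norm (p s y) \<le> M"
  proof -
    have "bounded ((\<lambda>x. p (fst x) (snd x)) ` K)"
      using compact_continuous_image[OF pc K] compact_imp_bounded by blast
    then show ?thesis
      using that unfolding bounded_pos K_def by force
  qed
  obtain B where B: "B > 0" "\<And>v. norm (P v) + norm (\<pi> v) \<le> B * norm v"
  proof -
    obtain B1 B2 where "B1 > 0" "B2 > 0" "\<And>v. norm (P v) \<le> norm v * B1" "\<And>v. norm (\<pi> v) \<le> norm v * B2"
      using P.pos_bounded \<pi>.pos_bounded by blast
    then show ?thesis
      by (intro that[of "B1 + B2"]) (auto simp: algebra_simps intro: add_mono)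
  qed
  \<comment> \<open>The worst amplification is by \<open>1 / s ^ 12\<close>. It is matched by the
    Taylor error, which is of third order at a point of norm at most
    \<open>s ^ 4 * M\<close>.\<close>
  have \<delta>bound: "norm (\<delta> s v) \<le> B * norm v / s ^ 12" if "0 < s" "s \<le> 1" for s v
  proof -
    have "1 / s ^ 8 \<le> 1 / s ^ 12"
      using that by (intro divide_left_mono power_decreasing) auto
    then have "norm (\<delta> s v) \<le> (1 / s ^ 12) * norm (P v) + (1 / s ^ 12) * norm (\<pi> v)"
      using norm_triangle_ineq[of "(1 / s ^ 8) *\<^sub>R P v" "(1 / s ^ 12) *\<^sub>R \<pi> v"] that
        mult_right_mono[of "1 / s ^ 8" "1 / s ^ 12" "norm (P v)"]
      by (simp add: \<delta>_def)
    also have "\<dots> \<le> (1 / s ^ 12) * (B * norm v)"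
      using B(2)[of v] that by (metis distrib_left mult_left_mono less_imp_le zero_less_divide_1_iff zero_less_power)
    finally show ?thesis by simp
  qed
  have \<delta>_inv: "\<delta> s (s ^ 8 *\<^sub>R P v + s ^ 12 *\<^sub>R \<pi> v) = v" if "0 < s" for s v
    using that by (simp add: \<delta>_def P.add P.scaleR \<pi>.add \<pi>.scaleR PP P\<pi> \<pi>P \<pi>\<pi> split)
  have \<delta>_inj: "v = v'" if "0 < s" "\<delta> s v = \<delta> s v'" for s v v'
  proof -
    have "s ^ 8 *\<^sub>R P (\<delta> s v) + s ^ 12 *\<^sub>R \<pi> (\<delta> s v) = v" for v
      using that(1) by (simp add: \<delta>_def P.add P.scaleR \<pi>.add \<pi>.scaleR PP P\<pi> \<pi>P \<pi>\<pi> split)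
    then show ?thesis using that(2) by metis
  qed
  have \<delta>_diff: "\<delta> s v - \<delta> s v' = \<delta> s (v - v')" for s v v'
    by (simp add: \<delta>_def P.diff \<pi>.diff algebra_simps)

  \<comment> \<open>Makes the rescaled Taylor error \<open>B * e * M ^ 3\<close> equal to
    \<open>r / 8\<close>.\<close>
  define e where "e = r / (8 * B * M ^ 3)"
  have e: "e > 0" unfolding e_def using r B M by simp
  obtain d1 where d1: "d1 > 0" "\<And>x. norm x < d1 \<Longrightarrow>
      norm (G x - (L x + (1/2) *\<^sub>R Q x x + (1/6) *\<^sub>R C x x x)) \<le> e * norm x ^ 3"
    using taylor[OF e] by blast
  obtain d2 where d2: "d2 > 0" "ball 0 d2 \<subseteq> N \<inter> V"
    using G V by (metis IntI open_Int openE)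
  have "uniformly_continuous_on K (\<lambda>x. \<Psi> (fst x) (snd x))"
    by (rule compact_uniformly_continuous[OF \<Psi>c K])
  then obtain d3 where d3: "d3 > 0" "\<And>x x'. x \<in> K \<Longrightarrow> x' \<in> K \<Longrightarrow> dist x' x < d3 \<Longrightarrow>
      dist (\<Psi> (fst x') (snd x')) (\<Psi> (fst x) (snd x)) < r / 8"
    unfolding uniformly_continuous_on_def using r by (metis divide_pos_pos zero_less_numeral)
  \<comment> \<open>As \<open>s \<le> 1\<close>, the points below have norm at most
    \<open>s * M\<close>, so conditions linear in \<open>s\<close> keep them in the Taylor ball and
    in \<open>N \<inter> V\<close>; \<open>s < d3\<close> brings \<open>\<Psi> s\<close> within
    \<open>r / 8\<close> of \<open>\<Psi> 0\<close>.\<close>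
  define s where "s = min (1/2) (min (d3 / 2) (min (d1 / (2 * M)) (d2 / (2 * M))))"
  have s: "0 < s" "s \<le> 1" "s < d3" "s * M < d1" "s * M < d2"
  proof -
    show "0 < s" "s \<le> 1" "s < d3" unfolding s_def using d1 d2 d3 M by auto
    have "s \<le> d1 / (2 * M)" "s \<le> d2 / (2 * M)" unfolding s_def by auto
    then have "s * M \<le> d1 / 2" "s * M \<le> d2 / 2" using M(1) by (auto simp: field_simps)
    then show "s * M < d1" "s * M < d2" using d1 d2 by auto
  qed

  define x where "x y = s ^ 4 *\<^sub>R p s y" for y
  have xnorm: "norm (x y) \<le> s ^ 4 * M" if "y \<in> cball 0 r" for y
    unfolding x_def using M(2)[OF _ that, of s] s by (simp add: mult_left_mono)
  have xsmall: "norm (x y) \<le> s * M" if "y \<in> cball 0 r" for y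
  proof -
    have "s ^ 4 \<le> s ^ 1" using s by (intro power_decreasing) auto
    then show ?thesis using order_trans[OF xnorm[OF that] mult_right_mono[of "s ^ 4" "s ^ 1" M]] M(1) by simp
  qed
  have "continuous_on (cball 0 r) x"
    unfolding x_def p_def q_def by (intro continuous_intros ak zc)
  moreover have xin: "x y \<in> N \<inter> V" if "y \<in> cball 0 r" for y
    using xsmall[OF that] s(5) d2(2) by (auto simp: subset_iff)
  ultimately have "continuous_on (cball 0 r) (\<lambda>y. G (x y))"
    by (intro continuous_on_compose2[OF G(1)]) auto
  then have "continuous_on (cball 0 r) (\<lambda>y. \<delta> s (G (x y)))"
    unfolding \<delta>_def by (intro continuous_intros P.continuous_on \<pi>.continuous_on)
  \<comment> \<open>The budget \<open>r / 2\<close> splits into \<open>r / 8\<close> for the Taylor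
    error, \<open>r / 8\<close> for passing from \<open>s\<close> to 0, and \<open>r / 4\<close>
    from \<open>near\<close>.\<close>
  moreover have "norm (\<delta> s (G (x y)) - y) \<le> r / 2" if y: "y \<in> cball 0 r" for y
  proof -
    let ?T = "L (x y) + (1/2) *\<^sub>R Q (x y) (x y) + (1/6) *\<^sub>R C (x y) (x y) (x y)"
    have "norm (x y) ^ 3 \<le> (s ^ 4 * M) ^ 3"
      using xnorm[OF y] by (intro power_mono) auto
    then have "norm (G (x y) - ?T) \<le> e * (s ^ 4 * M) ^ 3"
      using order_trans[OF d1(2)[OF order_le_less_trans[OF xsmall[OF y] s(4)]] mult_left_mono] e by simp
    then have "norm (\<delta> s (G (x y) - ?T)) \<le> B * (e * (s ^ 4 * M) ^ 3) / s ^ 12"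
      using s(1,2) B(1) by (intro order_trans[OF \<delta>bound] divide_right_mono mult_left_mono) auto
    also have "\<dots> = r / 8"
      using s(1) B(1) M(1) by (simp add: e_def power_mult_distrib flip: power_mult)
    finally have 1: "norm (\<delta> s (G (x y)) - \<delta> s ?T) \<le> r / 8" by (simp add: \<delta>_diff)
    have "\<delta> s ?T = \<Psi> s y"
      unfolding x_def model[OF y] by (rule \<delta>_inv[OF s(1)])
    moreover have "dist (\<Psi> s y) (\<Psi> 0 y) < r / 8"
      using d3(2)[of "(0, y)" "(s, y)"] s y by (auto simp: K_def dist_Pair_Pair)
    ultimately have "norm (\<delta> s (G (x y)) - \<Psi> 0 y) \<le> r / 8 + r / 8"
      using 1 norm_triangle_ineq[of "\<delta> s (G (x y)) - \<delta> s ?T" "\<Psi> s y - \<Psi> 0 y"] by (simp add: dist_norm)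
    then have "norm (\<delta> s (G (x y)) - y) \<le> (r / 8 + r / 8) + r / 4"
      using \<Psi>0[OF y] norm_triangle_ineq[of "\<delta> s (G (x y)) - \<Psi> 0 y" "\<Psi> 0 y - y"] by simp
    then show ?thesis by simp
  qed
  ultimately have onto: "cball 0 (r / 2) \<subseteq> (\<lambda>y. \<delta> s (G (x y))) ` cball 0 r"
    by (intro cball_subset_image_near_identity[OF r])
  \<comment> \<open>By \<open>\<delta>bound\<close> this radius brings \<open>\<delta> s v\<close>
    into the covered ball of radius \<open>r / 2\<close>; injectivity of \<open>\<delta> s\<close>
    then removes the rescaling.\<close>
  have "ball 0 (r * s ^ 12 / (2 * B)) \<subseteq> G ` V"
  proof
    fix v :: 'e assume "v \<in> ball 0 (r * s ^ 12 / (2 * B))"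
    then have small: "B * norm v / s ^ 12 \<le> r / 2"
      using B(1) s(1) by (simp add: field_simps)
    then have "\<delta> s v \<in> cball 0 (r / 2)"
      using order_trans[OF \<delta>bound[OF s(1,2)] small] by simp
    then obtain y where "y \<in> cball 0 r" "\<delta> s v = \<delta> s (G (x y))"
      using onto by blast
    then show "v \<in> G ` V"
      using \<delta>_inj[OF s(1)] xin by blast
  qed
  then show ?thesis
    using r s(1) B(1) by (intro interiorI[OF open_ball]) auto
qed

section \<open>The two sufficient conditions in a chart\<close>

lemma linear_generalized_inverse:
  fixes f :: "'a::real_vector \<Rightarrow> 'b::real_vector"
  assumes "linear f"
  obtains g where "linear g" "\<And>x. f (g (f x)) = f x"
  using real_vector.linear_exists_right_inverse_on[OF assms subspace_UNIV] by blast

section \<open>Arithmetic of cosets of the range of the differential\<close>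

lemma coker_proj_eq_iff:
  assumes "subspace (range (diff0 G))"
  shows "coker_proj G y = coker_proj G y' \<longleftrightarrow> y - y' \<in> range (diff0 G)"
proof
  assume "coker_proj G y = coker_proj G y'"
  moreover have "y \<in> coker_proj G y"
    using subspace_0[OF assms] unfolding coker_proj_def elt_set_plus_def by force
  ultimately show "y - y' \<in> range (diff0 G)"
    unfolding coker_proj_def elt_set_plus_def by auto
next
  assume d: "y - y' \<in> range (diff0 G)"
  have sub: "y +o range (diff0 G) \<subseteq> y' +o range (diff0 G)" if "y - y' \<in> range (diff0 G)" for y y'
  proof
    fix x assume "x \<in> y +o range (diff0 G)"
    then have "x - y \<in> range (diff0 G)" by (auto simp: elt_set_plus_def)
    then have "(y - y') + (x - y) \<in> range (diff0 G)"
      by (rule subspace_add[OF assms that])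
    then have "x - y' \<in> range (diff0 G)" by simp
    then show "x \<in> y' +o range (diff0 G)"
      unfolding elt_set_plus_def by (intro CollectI bexI[of _ "x - y'"]) simp_all
  qed
  then show "coker_proj G y = coker_proj G y'"
    using sub[OF d] sub[of y' y] subspace_neg[OF assms d] unfolding coker_proj_def minus_diff_eq by blast
qed

lemma coker_proj_add:
  assumes "subspace (range (diff0 G))"
  shows "coker_proj G y + coker_proj G y' = coker_proj G (y + y')"
proof -
  have "range (diff0 G) + range (diff0 G) = range (diff0 G)"
  proof
    show "range (diff0 G) + range (diff0 G) \<subseteq> range (diff0 G)"
      using subspace_add[OF assms] by (auto simp: set_plus_def)
    show "range (diff0 G) \<subseteq> range (diff0 G) + range (diff0 G)"
      using subspace_0[OF assms] by (intro set_zero_plus2)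
  qed
  then show ?thesis
    unfolding coker_proj_def by (simp add: set_plus_rearrange)
qed

locale C3_at_origin =
  fixes G :: "'a::real_normed_vector \<Rightarrow> 'e::euclidean_space" and N :: "'a set"
    and G1 G2 G3
  assumes derivatives: "has_C3_derivatives N G G1 G2 G3"
    and N: "open N" "0 \<in> N" and G0: "G 0 = 0"
begin

abbreviation L where "L \<equiv> G1 0"
abbreviation Q where "Q \<equiv> G2 0"
abbreviation C where "C \<equiv> G3 0"

lemma diff0_G: "diff0 G = blinfun_apply L"
  by (rule diff0_eq[OF derivatives N(2)])

lemma linear_L: "linear (blinfun_apply L)"
  by (simp add: bounded_linear.linear blinfun.bounded_linear_right)

lemma subspace_range: "subspace (range (blinfun_apply L))"
  by (intro linear_subspace_image linear_L subspace_UNIV)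

lemma coker_eq: "coker_proj G y = coker_proj G y' \<longleftrightarrow> y - y' \<in> range L"
  using coker_proj_eq_iff[of G] subspace_range by (simp add: diff0_G)

lemma coker_add: "coker_proj G y + coker_proj G y' = coker_proj G (y + y')"
  using coker_proj_add[of G] subspace_range by (simp add: diff0_G)

lemma range_scale_iff: "c \<noteq> 0 \<Longrightarrow> c *\<^sub>R y \<in> range L \<longleftrightarrow> y \<in> range L"
  using subspace_scale[OF subspace_range, of y c] subspace_scale[OF subspace_range, of "c *\<^sub>R y" "inverse c"]
  by auto

lemma multi_2: "ndiff0_multi 2 G [v, w] = (1/2) *\<^sub>R (Q v w + Q w v)"
  by (rule ndiff0_multi_2_eq) (rule ndiff0_eq[OF derivatives N])

text \<open>One third of the derivative of the cubic form of \<open>C\<close> at \<open>v\<close> in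
  direction \<open>u\<close>, the shape in which regularity is used later.\<close>

lemma multi_3: "ndiff0_multi 3 G [v, v, u] = (1/3) *\<^sub>R (C u v v + C v u v + C v v u)"
proof -
  have "ndiff0_multi 3 G [v, v, u] = (1/6) *\<^sub>R
      (C v v u + C v u v + C v v u + C v u v + C u v v + C u v v)"
    by (rule ndiff0_multi_3_eq) (rule ndiff0_eq[OF derivatives N])
  also have "\<dots> = (1/6) *\<^sub>R (2 *\<^sub>R (C u v v + C v u v + C v v u))"
    by (simp only: scaleR_2) (simp add: algebra_simps)
  finally show ?thesis by simp
qed

lemma dom_third_iff: "v \<in> dom_third G \<longleftrightarrow> L v = 0 \<and> (\<forall>x. Q v x + Q x v \<in> range L)"
  unfolding dom_third_def ker_diff0_def
  by (simp add: diff0_G coker_eq multi_2 range_scale_iff)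

lemma subspace_dom_third: "subspace (dom_third G)"
proof (intro subspaceI)
  show "0 \<in> dom_third G"
    using subspace_0[OF subspace_range] by (simp add: dom_third_iff)
  show "u + v \<in> dom_third G" if "u \<in> dom_third G" "v \<in> dom_third G" for u v
  proof -
    have "(Q u x + Q x u) + (Q v x + Q x v) \<in> range L" for x
      by (rule subspace_add[OF subspace_range]) (use that in \<open>auto simp: dom_third_iff\<close>)
    then show ?thesis
      using that by (simp add: dom_third_iff blinfun.bilinear_simps algebra_simps)
  qed
  show "c *\<^sub>R v \<in> dom_third G" if "v \<in> dom_third G" for c v
  proof -
    have "c *\<^sub>R (Q v x + Q x v) \<in> range L" for x
      by (rule subspace_scale[OF subspace_range]) (use that in \<open>auto simp: dom_third_iff\<close>)
    then show ?thesis
      using that by (simp add: dom_third_iff blinfun.bilinear_simps scaleR_add_right)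
  qed
qed

lemma taylor:
  "e > 0 \<Longrightarrow> \<exists>d>0. \<forall>x. norm x < d \<longrightarrow>
      norm (G x - (L x + (1/2) *\<^sub>R Q x x + (1/6) *\<^sub>R C x x x)) \<le> e * norm x ^ 3"
  using has_C3_derivatives_taylor[OF derivatives N, of e] by (simp add: G0)

lemma continuous_G: "continuous_on N G"
  using derivatives has_C1_derivative_continuous_on unfolding has_C3_derivatives_def by blast

section \<open>Openness of the chart representation in the two cases\<close>

text \<open>The complement of the range of \<open>L\<close> is a line spanned by the cubic value at
  \<open>v\<close>. Real cubing is onto with continuous inverse, so multiples of \<open>v\<close>
  solve the \<open>\<pi>\<close>-equation exactly.\<close>

lemma open_at_zero_corank_1:
  assumes "has_corank G 1" and v: "v \<in> dom_third G" "third G v \<noteq> coker_proj G 0"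
    and V: "open V" "0 \<in> V"
  shows "0 \<in> interior (G ` V)"
proof -
  obtain S where S: "linear S" "\<And>x. L (S (L x)) = L x"
    using linear_generalized_inverse[OF linear_L] by metis
  define \<pi> where "\<pi> y = y - L (S y)" for y
  have lin\<pi>: "linear \<pi>"
    unfolding \<pi>_def using linear_compose_sub[OF linear_ident linear_compose[OF S(1) linear_L]]
    by (simp add: o_def)
  have \<pi>0: "\<pi> y = 0 \<longleftrightarrow> y \<in> range L" for y
    unfolding \<pi>_def using S(2) by auto
  obtain b where b: "\<And>y. \<exists>c. \<pi> y = c *\<^sub>R \<pi> b"
  proof -
    obtain b :: "nat \<Rightarrow> 'e" where
      b: "\<forall>y\<in>coker0 G. \<exists>!c :: nat \<Rightarrow> real. c \<in> {..<1} \<rightarrow>\<^sub>E UNIV \<and> y = coker_proj G (\<Sum>i<1. c i *\<^sub>R b i)"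
      using assms(1) unfolding has_corank_def by blast
    have "\<exists>c. \<pi> y = c *\<^sub>R \<pi> (b 0)" for y
    proof -
      obtain c :: "nat \<Rightarrow> real" where "coker_proj G y = coker_proj G (\<Sum>i<1. c i *\<^sub>R b i)"
        using b unfolding coker0_def by blast
      then have "\<pi> (y - c 0 *\<^sub>R b 0) = 0"
        by (simp add: coker_eq \<pi>0)
      then show ?thesis
        using lin\<pi> by (auto simp: linear_diff linear_scale)
    qed
    then show ?thesis by (rule that)
  qed
  define e where "e = \<pi> ((1/6) *\<^sub>R C v v v)"
  have "e \<noteq> 0"
    using v(2) unfolding e_def third_def
    by (simp add: ndiff0_eq[OF derivatives N] coker_eq \<pi>0 range_scale_iff)
  obtain c0 where c0: "e = c0 *\<^sub>R \<pi> b"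
    using b unfolding e_def by blast
  with \<open>e \<noteq> 0\<close> have "c0 \<noteq> 0" by auto
  \<comment> \<open>Both \<open>\<pi> y\<close> and the nonzero \<open>e\<close> are multiples of
    \<open>\<pi> b\<close>; the inner product with \<open>e\<close> reads off the coefficient as a
    continuous function of \<open>y\<close>.\<close>
  have e: "\<pi> y = (\<pi> y \<bullet> e / (e \<bullet> e)) *\<^sub>R e" for y
  proof -
    obtain c where "\<pi> y = c *\<^sub>R \<pi> b" using b by blast
    then have "\<pi> y = (c / c0) *\<^sub>R e" using c0 \<open>c0 \<noteq> 0\<close> by simp
    then show ?thesis using \<open>e \<noteq> 0\<close> by simp
  qed
  \<comment> \<open>\<open>root 3\<close> is an odd continuous function on all of the reals, so
    negative coefficients are reached too.\<close>
  define l where "l y = root 3 (\<pi> y \<bullet> e / (e \<bullet> e))" for y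
  have l3: "l y ^ 3 = \<pi> y \<bullet> e / (e \<bullet> e)" for y
    unfolding l_def by (simp add: odd_real_root_pow)
  have cube: "C (l y *\<^sub>R v) (l y *\<^sub>R v) (l y *\<^sub>R v) = (l y ^ 3) *\<^sub>R C v v v" for y
    by (simp add: blinfun.bilinear_simps power3_eq_cube)
  have near: "\<pi> ((1/6) *\<^sub>R C (l y *\<^sub>R v) (l y *\<^sub>R v) (l y *\<^sub>R v)) = \<pi> y" for y
  proof -
    have "\<pi> ((1/6) *\<^sub>R C (l y *\<^sub>R v) (l y *\<^sub>R v) (l y *\<^sub>R v)) = (l y ^ 3) *\<^sub>R e"
      unfolding cube e_def linear_scale[OF lin\<pi>, symmetric] by (simp add: mult.commute)
    then show ?thesis using e[of y] by (simp add: l3)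
  qed
  have dom: "l y *\<^sub>R v \<in> dom_third G" for y
    by (rule subspace_scale[OF subspace_dom_third v(1)])
  have "continuous_on (cball 0 1) \<pi>"
    using lin\<pi> linear_continuous_on linear_conv_bounded_linear by blast
  then have cont: "continuous_on (cball 0 1) (\<lambda>y. l y *\<^sub>R v)"
    unfolding l_def using \<open>e \<noteq> 0\<close> by (intro continuous_intros) auto
  show ?thesis
    \<comment> \<open>The error in \<open>near\<close> is 0, so any positive radius would do; 1 is
      taken.\<close>
    by (rule open_at_zero_of_third_order_model[OF taylor continuous_G N S, where w = 0 and r = 1
          and a = "\<lambda>y. l y *\<^sub>R v" and k = "\<lambda>_. 0"])
      (use cont dom near subspace_0[OF subspace_range] V in \<open>auto simp: dom_third_iff \<pi>_def[symmetric]\<close>)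
qed

text \<open>Regularity makes the linearization of the \<open>\<pi>\<close>-part of the model, at
  \<open>a = v\<close> and \<open>k = 0\<close>, onto modulo the range of \<open>L\<close>.
  Following a linear right inverse of it, the model agrees with \<open>y\<close> to first
  order.\<close>

lemma open_at_zero_regular_zero:
  assumes w: "w \<in> Iso G" and v: "regular_zero G w v" and V: "open V" "0 \<in> V"
  shows "0 \<in> interior (G ` V)"
proof -
  obtain S where S: "linear S" "\<And>x. L (S (L x)) = L x"
    using linear_generalized_inverse[OF linear_L] by metis
  define \<pi> where "\<pi> y = y - L (S y)" for y
  have bS: "bounded_linear S" using S(1) by (simp add: linear_conv_bounded_linear)
  have b\<pi>: "bounded_linear \<pi>"
    unfolding \<pi>_def
    by (intro bounded_linear_sub bounded_linear_ident bounded_linear_compose[OF blinfun.bounded_linear_right bS])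
  interpret \<pi>: bounded_linear \<pi> by (rule b\<pi>)
  have \<pi>0: "\<pi> y = 0" if "y \<in> range L" for y
    using S(2) that by (auto simp: \<pi>_def)
  have w: "L w = 0" "Q w w \<in> range L"
    using w unfolding Iso_def ker_diff0_def Hess_def
    by (auto simp: diff0_G coker_eq ndiff0_eq[OF derivatives N])
  have v: "v \<in> dom_third G" "C v v v \<in> range L"
    and onto: "(\<lambda>u. coker2_proj G w (third_trilin G v v u)) ` dom_third G = coker2 G w"
    using v unfolding regular_zero_def third_def
    by (auto simp: coker_eq ndiff0_eq[OF derivatives N])
  \<comment> \<open>A representative of
    \<open>third_trilin G v v u + Hess_bilin G w k\<close>.\<close>
  define \<Lambda> where "\<Lambda> u k = (1/3) *\<^sub>R (C u v v + C v u v + C v v u) + (1/2) *\<^sub>R (Q w k + Q k w)" for u k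
  have "\<exists>u k. u \<in> dom_third G \<and> L k = 0 \<and> b - \<Lambda> u k \<in> range L" for b
  proof -
    have "coker2_proj G w (coker_proj G b) \<in> coker2 G w"
      unfolding coker2_def coker0_def by blast
    then obtain u where u: "u \<in> dom_third G"
      "coker2_proj G w (coker_proj G b) = coker2_proj G w (third_trilin G v v u)"
      using onto by (metis (no_types, lifting) imageE)
    \<comment> \<open>\<open>Im2 G w\<close> contains the zero class, so the class of
      \<open>b\<close> lies in its own second-level coset. That coset is also the one of
      \<open>third_trilin G v v u\<close>, and membership in it produces \<open>k\<close>.\<close>
    have "Hess_bilin G w 0 = coker_proj G 0"
      unfolding Hess_bilin_def by (simp add: multi_2)
    then have "coker_proj G 0 \<in> Im2 G w"
      unfolding Im2_def ker_diff0_def by (metis (mono_tags, lifting) diff0_G blinfun.zero_right imageI mem_Collect_eq)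
    then have "coker_proj G b \<in> coker2_proj G w (coker_proj G b)"
      unfolding coker2_proj_def elt_set_plus_def using coker_add[of b 0] by force
    then obtain k where "L k = 0" "coker_proj G b = third_trilin G v v u + Hess_bilin G w k"
      unfolding u(2) unfolding coker2_proj_def elt_set_plus_def Im2_def ker_diff0_def
      by (auto simp: diff0_G)
    then have "coker_proj G b = coker_proj G (\<Lambda> u k)"
      unfolding third_trilin_def Hess_bilin_def by (simp add: coker_add multi_2 multi_3 \<Lambda>_def)
    then show ?thesis using u(1) \<open>L k = 0\<close> coker_eq by blast
  qed
  then obtain U K where UK: "\<And>b. U b \<in> dom_third G" "\<And>b. L (K b) = 0" "\<And>b. b - \<Lambda> (U b) (K b) \<in> range L"
    by metis
  \<comment> \<open>The chosen \<open>U\<close> and \<open>K\<close> need not be linear; only their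
    values on \<open>Basis\<close> are kept and extended linearly.\<close>
  define u where "u y = (\<Sum>b\<in>Basis. (y \<bullet> b) *\<^sub>R U b)" for y
  define k where "k y = (\<Sum>b\<in>Basis. (y \<bullet> b) *\<^sub>R K b)" for y
  have bu: "bounded_linear u" and bk: "bounded_linear k"
    unfolding u_def k_def
    by (intro bounded_linear_sum bounded_linear_scaleR_const bounded_linear_inner_left)+
  have u0: "u 0 = 0" and k0: "k 0 = 0"
    by (simp_all add: u_def k_def)
  have udom: "u y \<in> dom_third G" for y
    unfolding u_def by (intro subspace_sum subspace_scale subspace_dom_third UK)
  have Lk: "L (k y) = 0" for y
    by (simp add: k_def blinfun.sum_right blinfun.scaleR_right UK)
  have \<Lambda>: "y - \<Lambda> (u y) (k y) \<in> range L" for y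
  proof -
    have "\<Lambda> (u y) (k y) = (\<Sum>b\<in>Basis. (y \<bullet> b) *\<^sub>R \<Lambda> (U b) (K b))"
      unfolding \<Lambda>_def u_def k_def
      by (simp add: blinfun.sum_right blinfun.sum_left blinfun.scaleR_right blinfun.scaleR_left
          scaleR_add_right sum.distrib scaleR_sum_right mult.commute)
    then have "y - \<Lambda> (u y) (k y) = (\<Sum>b\<in>Basis. (y \<bullet> b) *\<^sub>R (b - \<Lambda> (U b) (K b)))"
      by (simp add: scaleR_diff_right sum_subtractf euclidean_representation)
    also have "\<dots> \<in> range L"
      by (intro subspace_sum subspace_scale subspace_range UK)
    finally show ?thesis .
  qed
  \<comment> \<open>The factor 2 turns the derivative of one sixth of the cubic form into the factor
    \<open>1/3\<close> in \<open>\<Lambda>\<close>.\<close>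
  define a where "a y = v + 2 *\<^sub>R u y" for y
  have adom: "a y \<in> dom_third G" for y
    unfolding a_def by (intro subspace_add subspace_scale subspace_dom_third v udom)
  \<comment> \<open>The error in \<open>near\<close>. It vanishes at 0 because
    \<open>C v v v\<close> lies in the range of \<open>L\<close>, and its derivative there vanishes
    by the choice of \<open>u\<close> and \<open>k\<close>; hence it is at most a quarter of
    \<open>norm y\<close> on a small ball.\<close>
  define f where "f y = \<pi> ((1/2) *\<^sub>R (Q w (k y) + Q (k y) w) + (1/6) *\<^sub>R C (a y) (a y) (a y)) - \<pi> y" for y
  have da: "(a has_derivative (\<lambda>h. 2 *\<^sub>R u h)) (at 0)"
    unfolding a_def by (auto intro!: derivative_eq_intros bounded_linear_imp_has_derivative bu)
  have dk: "(k has_derivative k) (at 0)"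
    by (rule bounded_linear_imp_has_derivative[OF bk])
  have "((\<lambda>y. (1/2) *\<^sub>R (Q w (k y) + Q (k y) w) + (1/6) *\<^sub>R C (a y) (a y) (a y)) has_derivative
      (\<lambda>h. \<Lambda> (u h) (k h))) (at 0)"
    by (rule has_derivative_eq_rhs, (rule derivative_intros da dk)+)
      (auto simp: fun_eq_iff \<Lambda>_def a_def u0 blinfun.bilinear_simps algebra_simps)
  then have "((\<lambda>y. (1/2) *\<^sub>R (Q w (k y) + Q (k y) w) + (1/6) *\<^sub>R C (a y) (a y) (a y) - y) has_derivative
      (\<lambda>h. \<Lambda> (u h) (k h) - h)) (at 0)"
    by (intro derivative_intros)
  then have "((\<lambda>y. \<pi> ((1/2) *\<^sub>R (Q w (k y) + Q (k y) w) + (1/6) *\<^sub>R C (a y) (a y) (a y) - y)) has_derivative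
      (\<lambda>h. \<pi> (\<Lambda> (u h) (k h) - h))) (at 0)"
    by (rule \<pi>.has_derivative)
  moreover have "\<pi> (\<Lambda> (u h) (k h) - h) = 0" for h
    using \<pi>0[OF \<Lambda>[of h]] by (simp add: \<pi>.diff)
  ultimately have "(f has_derivative (\<lambda>_. 0)) (at 0)"
    by (simp add: f_def[abs_def] \<pi>.diff)
  then obtain d where d: "d > 0" "\<And>y. norm y < d \<Longrightarrow> norm (f y - f 0) \<le> 1/4 * norm y"
    unfolding has_derivative_at_alt by (auto dest!: spec[of _ "1/4"])
  have f0: "f 0 = 0"
    using \<pi>0[OF v(2)] by (simp add: f_def a_def u0 k0 \<pi>.scaleR)
  have near: "norm (f y) \<le> (d / 2) / 4" if "y \<in> cball 0 (d / 2)" for y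
    using d(2)[of y] that d(1) by (simp add: f0)
  have cont: "continuous_on (cball 0 (d / 2)) a" "continuous_on (cball 0 (d / 2)) k"
    unfolding a_def by (intro continuous_intros linear_continuous_on bu bk)+
  show ?thesis
    by (rule open_at_zero_of_third_order_model[OF taylor continuous_G N S w, where r = "d / 2"
          and a = a and k = k])
      (use d(1) cont adom Lk near V in \<open>auto simp: dom_third_iff f_def \<pi>_def[symmetric]\<close>)
qed

end

section \<open>Passage to the manifold\<close>

text \<open>Smoothness of \<open>F\<close> is given in the charts of \<open>A\<close>, while
  \<open>\<phi>\<close> is only compatible with them. So \<open>\<phi> \<circ> F\<close> is factored
  near 0 through an atlas chart \<open>\<psi>\<close> around \<open>F 0\<close> and the transition
  from \<open>\<psi>\<close> to \<open>\<phi>\<close>.\<close>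

lemma smooth_mapping_in_chart_has_C3_derivatives:
  fixes U :: "'a::real_normed_vector set"
    and A :: "('m::{t2_space,second_countable_topology}, 'e::euclidean_space) chart set"
  assumes "open U" "0 \<in> U" "smooth_atlas A" "smooth_mapping A U F"
    and "smooth_chart A (D, \<phi>)" "F 0 \<in> D"
  obtains N G1 G2 G3 where "open N" "0 \<in> N" "N \<subseteq> U \<inter> F -` D"
    "has_C3_derivatives N (\<phi> \<circ> F) G1 G2 G3"
proof -
  obtain D' \<psi> where c: "(D', \<psi>) \<in> A" "F 0 \<in> D'"
  proof -
    have "F 0 \<in> (\<Union>c\<in>A. fst c)" using assms(3) unfolding smooth_atlas_def by blast
    then show ?thesis using that by auto
  qed
  obtain \<psi>' where D': "open D'" "open (\<psi> ` D')" "homeomorphism D' (\<psi> ` D') \<psi> \<psi>'"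
    using assms(3) c(1) unfolding smooth_atlas_def is_chart_def by blast
  have D: "open D" using assms(5) unfolding smooth_chart_def is_chart_def by blast
  have F: "continuous_on U F" "smooth_on (U \<inter> F -` D') (\<psi> \<circ> F)"
    using assms(4) c(1) unfolding smooth_mapping_def by blast+
  have T: "smooth_on (\<psi> ` (D' \<inter> D)) (\<phi> \<circ> inv_into D' \<psi>)"
    using assms(5) c(1) unfolding smooth_chart_def smooth_transition_def by blast
  have preimage: "open (U \<inter> F -` E)" if "open E" for E
    using continuous_open_preimage[OF F(1) assms(1) that] .
  have "openin (top_of_set (\<psi> ` D')) (\<psi> ` (D' \<inter> D))"
    using D'(1) D by (intro homeomorphism_imp_open_map[OF D'(3)]) auto
  then have open_image: "open (\<psi> ` (D' \<inter> D))"
    using D'(2) by (rule openin_open_trans)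
  obtain t1 t2 t3 where t: "has_C3_derivatives (\<psi> ` (D' \<inter> D)) (\<phi> \<circ> inv_into D' \<psi>) t1 t2 t3"
    using smooth_on_imp_has_C3_derivatives[OF T open_image] by blast
  obtain f1 f2 f3 where "has_C3_derivatives (U \<inter> F -` D') (\<psi> \<circ> F) f1 f2 f3"
    using smooth_on_imp_has_C3_derivatives[OF F(2) preimage[OF D'(1)]] by blast
  then have f: "has_C3_derivatives (U \<inter> F -` (D' \<inter> D)) (\<psi> \<circ> F) f1 f2 f3"
    by (rule has_C3_derivatives_subset) auto
  have N: "open (U \<inter> F -` (D' \<inter> D))"
    using preimage D'(1) D by blast
  obtain g1 g2 g3 where comp: "has_C3_derivatives (U \<inter> F -` (D' \<inter> D))
      (\<lambda>x. (\<phi> \<circ> inv_into D' \<psi>) ((\<psi> \<circ> F) x)) g1 g2 g3"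
    using has_C3_derivatives_compose[OF t f] by auto
  have "inj_on \<psi> D'"
    using D'(3) unfolding homeomorphism_def by (metis inj_on_inverseI)
  then have "has_C3_derivatives (U \<inter> F -` (D' \<inter> D)) (\<phi> \<circ> F) g1 g2 g3"
    by (intro has_C3_derivatives_cong[OF comp N]) auto
  then show ?thesis
    using that[OF N] assms(2,6) c(2) by blast
qed

lemma open_at_origin_if_open_in_chart:
  fixes U :: "'a::real_normed_vector set" and D :: "'m::topological_space set" and \<phi> :: "'m \<Rightarrow> 'e::euclidean_space"
  assumes "is_chart (D, \<phi>)" "F 0 \<in> D" "open N" "0 \<in> N" "N \<subseteq> F -` D"
    and image: "\<And>V. open V \<Longrightarrow> 0 \<in> V \<Longrightarrow> \<phi> (F 0) \<in> interior ((\<phi> \<circ> F) ` V)"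
  shows "open_at_origin U F"
  unfolding open_at_origin_def
proof (intro allI impI)
  fix V assume "V \<subseteq> U" and V: "0 \<in> interior V"
  \<comment> \<open>Shrinking to \<open>N\<close> keeps \<open>F\<close> inside \<open>D\<close>,
    where \<open>\<phi>\<close> is injective; equal coordinates then mean equal points.\<close>
  define W where "W = interior V \<inter> N"
  have W: "\<phi> (F 0) \<in> interior ((\<phi> \<circ> F) ` W)"
    using assms(3,4) V unfolding W_def by (intro image) auto
  obtain \<phi>' where D: "open D" "homeomorphism D (\<phi> ` D) \<phi> \<phi>'"
    using assms(1) unfolding is_chart_def by blast
  have "open (D \<inter> \<phi> -` interior ((\<phi> \<circ> F) ` W))"
    using D by (intro continuous_open_preimage) (auto simp: homeomorphism_def)
  moreover have "D \<inter> \<phi> -` interior ((\<phi> \<circ> F) ` W) \<subseteq> F ` V"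
  proof
    fix m assume m: "m \<in> D \<inter> \<phi> -` interior ((\<phi> \<circ> F) ` W)"
    then obtain x where x: "x \<in> W" "\<phi> m = \<phi> (F x)"
      using interior_subset by fastforce
    moreover have "F x \<in> D" using x(1) assms(5) by (auto simp: W_def)
    ultimately have "m = F x"
      using m D(2) unfolding homeomorphism_def by (metis IntD1)
    then show "m \<in> F ` V"
      using x(1) interior_subset by (auto simp: W_def)
  qed
  ultimately show "F 0 \<in> interior (F ` V)"
    using assms(2) W by (intro interiorI) auto
qed

theorem theorem1p1:
  fixes U :: "'a::banach set"
    and A :: "('m::{t2_space,second_countable_topology}, 'e::euclidean_space) chart set"
    and F :: "'a \<Rightarrow> 'm"
    and D :: "'m set" and \<phi> :: "'m \<Rightarrow> 'e"
    and h :: nat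
  assumes "open U" and "0 \<in> U"
    and "smooth_atlas A"
    and "smooth_mapping A U F"
    and "smooth_chart A (D, \<phi>)" and "F 0 \<in> D" and "\<phi> (F 0) = 0"
    and "\<not> surj (diff0 (\<phi> \<circ> F))"
    and "has_corank (\<phi> \<circ> F) h" and "h \<ge> 1"
  shows "(h = 1 \<longrightarrow> (\<exists>v\<in>dom_third (\<phi> \<circ> F). third (\<phi> \<circ> F) v \<noteq> coker_proj (\<phi> \<circ> F) 0)
             \<longrightarrow> open_at_origin U F) \<and>
         ((\<exists>w0\<in>Iso (\<phi> \<circ> F). \<exists>v0\<in>dom_third (\<phi> \<circ> F). regular_zero (\<phi> \<circ> F) w0 v0)
             \<longrightarrow> open_at_origin U F)"
proof -
  obtain N G1 G2 G3 where nbhd: "open N" "0 \<in> N" "N \<subseteq> U \<inter> F -` D"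
    and G: "has_C3_derivatives N (\<phi> \<circ> F) G1 G2 G3"
    using smooth_mapping_in_chart_has_C3_derivatives[OF assms(1-6)] by blast
  interpret C3_at_origin "\<phi> \<circ> F" N G1 G2 G3
    by unfold_locales (use G nbhd assms(7) in auto)
  have chart: "is_chart (D, \<phi>)"
    using assms(5) unfolding smooth_chart_def by blast
  have *: "open_at_origin U F"
    if "\<And>V. open V \<Longrightarrow> 0 \<in> V \<Longrightarrow> 0 \<in> interior ((\<phi> \<circ> F) ` V)"
    using that assms(7) nbhd(1,2) by (intro open_at_origin_if_open_in_chart[where F = F and N = N, OF chart])
      (use nbhd(3) in \<open>auto simp: assms(6)\<close>)
  show ?thesis
    using * open_at_zero_corank_1 open_at_zero_regular_zero assms(9) by blast
qed

end
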